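(* Let $A$ and $B$ be compact operators on a complex Hilbert space $H$, at least one of which is nonzero. Then $A$ and $B$ are both normal and commute with each other if and only if $\sigma_p(A,A^*,B,B^* )$ is the union of countably many, locally finite, complex hyperplanes in $\mathbb C^4$.
   Context: For an $n$-tuple $(A_1,\dots,A_n)$ of bounded linear operators on $H$, the joint point spectrum is $$\sigma_p(A_1,\dots,A_n)=\{(z_1,\dots,z_n)\in\mathbb C^n:\ker(I+z_1A_1+\cdots+z_nA_n)\neq(0)\}.$$ A complex hyperplane in $\mathbb C^n$ is an affine complex subspace of codimension one. "Countably many" includes finitely many. A family of hyperplanes is locally finite if every point of $\mathbb C^n$ has a neighborhood meeting only finitely many members of the family. *)

theory Defs
  imports "HOL-Analysis.Analysis"
begin

text \<open>
  The class extends the real inner product space underlying a complex Hilbert space; its real inner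
  product is required to be the real part of the complex one, so that the inherited
  norm is \<open>sqrt (Re (cinner x x))\<close> and positive definiteness is inherited as well.
  The complex inner product is linear in its first argument.
\<close>

class scaleC =
  fixes scaleC :: "complex \<Rightarrow> 'a \<Rightarrow> 'a"  (infixr "*\<^sub>C" 75)

class complex_hilbert_space = real_inner + banach + scaleC +
  fixes cinner :: "'a \<Rightarrow> 'a \<Rightarrow> complex"
  assumes scaleC_add_right: "c *\<^sub>C (x + y) = c *\<^sub>C x + c *\<^sub>C y"
    and scaleC_add_left: "(c + d) *\<^sub>C x = c *\<^sub>C x + d *\<^sub>C x"
    and scaleC_scaleC: "c *\<^sub>C (d *\<^sub>C x) = (c * d) *\<^sub>C x"
    and scaleC_of_real: "complex_of_real r *\<^sub>C x = r *\<^sub>R x"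
    and cinner_commute: "cinner x y = cnj (cinner y x)"
    and cinner_add_left: "cinner (x + y) z = cinner x z + cinner y z"
    and cinner_scaleC_left: "cinner (c *\<^sub>C x) y = c * cinner x y"
    and inner_eq_Re_cinner: "x \<bullet> y = Re (cinner x y)"

text \<open>
  The type \<open>'h \<Rightarrow>\<^sub>L 'h\<close> consists of the bounded \<^emph>\<open>real\<close>-linear maps; the bounded operators on the
  complex space are those that are moreover homogeneous over the complex numbers.
\<close>

definition complex_linear :: "('h::complex_hilbert_space \<Rightarrow>\<^sub>L 'h) \<Rightarrow> bool" where
  "complex_linear A \<longleftrightarrow> (\<forall>c x. A (c *\<^sub>C x) = c *\<^sub>C A x)"

definition compact_operator :: "('h::complex_hilbert_space \<Rightarrow>\<^sub>L 'h) \<Rightarrow> bool" where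
  "compact_operator A \<longleftrightarrow> complex_linear A \<and> compact (closure (blinfun_apply A ` cball 0 1))"

definition hilbert_adjoint :: "('h::complex_hilbert_space \<Rightarrow>\<^sub>L 'h) \<Rightarrow> ('h \<Rightarrow>\<^sub>L 'h)" where
  "hilbert_adjoint A = (THE B. \<forall>x y. cinner (A x) y = cinner x (blinfun_apply B y))"

definition normal_operator :: "('h::complex_hilbert_space \<Rightarrow>\<^sub>L 'h) \<Rightarrow> bool" where
  "normal_operator A \<longleftrightarrow> A o\<^sub>L hilbert_adjoint A = hilbert_adjoint A o\<^sub>L A"

definition joint_point_spectrum ::
    "('h::complex_hilbert_space \<Rightarrow>\<^sub>L 'h) ^ 'n::finite \<Rightarrow> (complex ^ 'n) set" where
  "joint_point_spectrum T = {z. {x. x + (\<Sum>i\<in>UNIV. z $ i *\<^sub>C (T $ i) x) = 0} \<noteq> {0}}"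

text \<open>
  The prefix \<open>vec\<close> refers to \<open>complex ^ 'n\<close> as a vector space over the complex numbers, so subspace
  and dimension are complex.
\<close>

definition complex_hyperplane :: "(complex ^ 'n::finite) set \<Rightarrow> bool" where
  "complex_hyperplane S \<longleftrightarrow>
    (\<exists>V p. vec.subspace V \<and> vec.dim V + 1 = CARD('n) \<and> S = (\<lambda>v. p + v) ` V)"

end

theory Submission
  imports Defs
begin

text \<open>
  If \<open>A\<close> and \<open>B\<close> are commuting compact normal operators, common eigenvectors are total
  (\<open>common_eigenvectors_total\<close>), so the joint spectrum is the union of the hyperplanes
  \<open>1 + z\<^sub>1 a + z\<^sub>2 cnj a + z\<^sub>3 b + z\<^sub>4 cnj b = 0\<close> over the joint eigenvalues \<open>(a, b) \<noteq> (0, 0)\<close>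
  (\<open>joint_point_spectrum_normal\<close>). By compactness only finitely many joint eigenvalues have modulus
  above a given bound, and only those can give a hyperplane that comes near a given point.

  For the converse, all symmetric operators of the form \<open>z\<^sub>1 A + z\<^sub>2 A\<^sup>* + z\<^sub>3 B + z\<^sub>4 B\<^sup>*\<close> have to commute,
  because the real and imaginary parts of \<open>A\<close> and \<open>B\<close> are among them. For two such operators \<open>P\<close> and
  \<open>Q\<close> the hypothesis says that near a nonzero value the eigenvalues \<open>\<nu>\<close> of \<open>P + t Q\<close> lie on finitely
  many lines \<open>\<nu> = \<alpha> + t \<beta>\<close> (\<open>locally_linear_eigenvalues_pencil\<close>). In particular the top eigenvalue of
  \<open>P + t Q\<close> is linear along a sequence of parameters \<open>t\<close> that decreases to 0. But the top eigenvalue is the maximum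
  of the form, and it exceeds its first order approximation by a term of order \<open>t\<^sup>2\<close> unless a top
  eigenvector of \<open>P\<close> is also an eigenvector of \<open>Q\<close>. So there is a common eigenvector
  (\<open>common_eigenvector\<close>). The same applies within every closed invariant subspace on which the form
  of \<open>P\<close> or of \<open>- P\<close> is positive somewhere, and this forces \<open>P\<close> to vanish on the orthogonal complement
  of all common eigenvectors; hence \<open>P\<close> and \<open>Q\<close> commute
  (\<open>commute_of_locally_linear_eigenvalues\<close>).
\<close>

section \<open>Compact symmetric maps on real inner product spaces\<close>

text \<open>
  The spectral arguments only use real parts of inner products and real eigenvalues of symmetric
  maps, so they are carried out over the reals.
\<close>

definition compact_map :: "('a::real_normed_vector \<Rightarrow> 'b::real_normed_vector) \<Rightarrow> bool" where
  "compact_map T \<longleftrightarrow> bounded_linear T \<and>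
    (\<forall>x. (\<forall>n. norm (x n) \<le> 1) \<longrightarrow>
      (\<exists>l (r :: nat \<Rightarrow> nat). strict_mono r \<and> (\<lambda>n. T (x (r n))) \<longlonglongrightarrow> l))"

definition symmetric_map :: "('a::real_inner \<Rightarrow> 'a) \<Rightarrow> bool" where
  "symmetric_map T \<longleftrightarrow> (\<forall>x y. T x \<bullet> y = x \<bullet> T y)"

lemma compact_mapD:
  assumes "compact_map T" and "\<And>n. norm (x n) \<le> 1"
  obtains l and r :: "nat \<Rightarrow> nat" where "strict_mono r" "(\<lambda>n. T (x (r n))) \<longlonglongrightarrow> l"
  using assms unfolding compact_map_def by blast

lemma compact_map_add:
  assumes "compact_map S" "compact_map T"
  shows "compact_map (\<lambda>x. S x + T x)"
  unfolding compact_map_def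
proof (intro conjI allI impI)
  show "bounded_linear (\<lambda>x. S x + T x)"
    using assms bounded_linear_add unfolding compact_map_def by blast
  fix x :: "nat \<Rightarrow> 'a" assume x: "\<forall>n. norm (x n) \<le> 1"
  obtain l r where r: "strict_mono r" "(\<lambda>n. S (x (r n))) \<longlonglongrightarrow> l"
    using compact_mapD[OF assms(1)] x by metis
  obtain l' r' where r': "strict_mono r'" "(\<lambda>n. T (x (r (r' n)))) \<longlonglongrightarrow> l'"
    using compact_mapD[OF assms(2), of "\<lambda>n. x (r n)"] x by metis
  have "(\<lambda>n. S (x (r (r' n)))) \<longlonglongrightarrow> l"
    using LIMSEQ_subseq_LIMSEQ[OF r(2) r'(1)] by (simp add: o_def)
  then have "(\<lambda>n. S (x ((r \<circ> r') n)) + T (x ((r \<circ> r') n))) \<longlonglongrightarrow> l + l'"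
    using r' by (auto intro: tendsto_add)
  with strict_mono_o[OF r(1) r'(1)]
  show "\<exists>l r. strict_mono r \<and> (\<lambda>n. S (x (r n)) + T (x (r n))) \<longlonglongrightarrow> l" by blast
qed

lemma compact_map_compose_left:
  fixes T :: "'a::real_normed_vector \<Rightarrow> 'b::real_normed_vector"
  assumes "bounded_linear S" "compact_map T"
  shows "compact_map (\<lambda>x. S (T x))"
  unfolding compact_map_def
proof (intro conjI allI impI)
  show "bounded_linear (\<lambda>x. S (T x))"
    using assms bounded_linear_compose unfolding compact_map_def by blast
  fix x :: "nat \<Rightarrow> 'a" assume x: "\<forall>n. norm (x n) \<le> 1"
  obtain l r where r: "strict_mono r" "(\<lambda>n. T (x (r n))) \<longlonglongrightarrow> l"
    using compact_mapD[OF assms(2)] x by metis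
  then show "\<exists>l r. strict_mono r \<and> (\<lambda>n. S (T (x (r n)))) \<longlonglongrightarrow> l"
    using bounded_linear.tendsto[OF assms(1)] by blast
qed

lemma compact_map_uminus: "compact_map T \<Longrightarrow> compact_map (\<lambda>x. - T x)"
  using compact_map_compose_left[OF bounded_linear_minus[OF bounded_linear_ident]] .

lemma compact_map_scaleR: "compact_map T \<Longrightarrow> compact_map (\<lambda>x. c *\<^sub>R T x)"
  using compact_map_compose_left[OF bounded_linear_scaleR_right] .

lemma symmetric_map_add:
  "symmetric_map S \<Longrightarrow> symmetric_map T \<Longrightarrow> symmetric_map (\<lambda>x. S x + T x)"
  by (simp add: symmetric_map_def inner_add_left inner_add_right)

lemma symmetric_map_uminus: "symmetric_map T \<Longrightarrow> symmetric_map (\<lambda>x. - T x)"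
  by (simp add: symmetric_map_def)

lemma symmetric_map_scaleR: "symmetric_map T \<Longrightarrow> symmetric_map (\<lambda>x. c *\<^sub>R T x)"
  by (simp add: symmetric_map_def)

text \<open>
  A maximizing sequence for the quadratic form on the unit sphere of \<open>W\<close> is a sequence of
  approximate eigenvectors, and compactness of \<open>T\<close> makes a subsequence converge because the
  supremum \<open>m\<close> is not zero.
\<close>

lemma top_eigenvector:
  fixes T :: "'a::real_inner \<Rightarrow> 'a"
  assumes T: "compact_map T" "symmetric_map T"
    and W: "subspace W" "closed W" "\<And>x. x \<in> W \<Longrightarrow> T x \<in> W"
    and pos: "x0 \<in> W" "T x0 \<bullet> x0 > 0"
  obtains m x where "m > 0" "x \<in> W" "norm x = 1" "T x = m *\<^sub>R x"
    "\<And>y. y \<in> W \<Longrightarrow> T y \<bullet> y \<le> m * (y \<bullet> y)"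
proof -
  interpret T: bounded_linear T using T(1) by (simp add: compact_map_def)
  obtain K where K: "K > 0" "\<And>x. norm (T x) \<le> norm x * K" using T.pos_bounded by blast
  have form_bound: "\<bar>T x \<bullet> x\<bar> \<le> K * (x \<bullet> x)" for x
  proof -
    have "\<bar>T x \<bullet> x\<bar> \<le> norm (T x) * norm x" by (rule Cauchy_Schwarz_ineq2)
    also have "\<dots> \<le> (norm x * K) * norm x" by (intro mult_right_mono K) simp
    finally show ?thesis by (simp add: dot_square_norm power2_eq_square algebra_simps)
  qed
  have dot1: "x \<bullet> x = 1" if "norm x = 1" for x :: 'a using that by (simp add: dot_square_norm)
  define S where "S = (\<lambda>x. T x \<bullet> x) ` {x \<in> W. norm x = 1}"
  define m where "m = Sup S"
  have bdd: "bdd_above S"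
  proof (rule bdd_aboveI)
    fix a assume "a \<in> S"
    then obtain y where y: "a = T y \<bullet> y" "norm y = 1" by (auto simp: S_def)
    show "a \<le> K" using form_bound[of y] dot1[OF y(2)] y(1) by simp
  qed
  have scale: "T y \<bullet> y = (T (y /\<^sub>R norm y) \<bullet> (y /\<^sub>R norm y)) * (y \<bullet> y)" if "y \<noteq> 0" for y
    using that by (simp add: T.scaleR dot_square_norm power2_eq_square field_simps)
  have unit: "T (y /\<^sub>R norm y) \<bullet> (y /\<^sub>R norm y) \<in> S" if "y \<noteq> 0" "y \<in> W" for y
    unfolding S_def using that W(1) by (intro imageI) (simp add: subspace_scale)
  have le: "T y \<bullet> y \<le> m * (y \<bullet> y)" if "y \<in> W" for y
  proof (cases "y = 0")
    case False
    then show ?thesis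
      unfolding scale[OF False] m_def
      by (intro mult_right_mono cSup_upper unit bdd that) auto
  qed (simp add: T.zero)
  have "x0 \<noteq> 0" using pos(2) by (auto simp: T.zero)
  have "0 < m * (x0 \<bullet> x0)" using le[OF pos(1)] pos(2) by linarith
  then have "m > 0" by (rule zero_less_mult_pos2) (simp add: \<open>x0 \<noteq> 0\<close>)
  have "S \<noteq> {}" using unit[OF \<open>x0 \<noteq> 0\<close> pos(1)] by blast
  have "\<exists>x. x \<in> W \<and> norm x = 1 \<and> m - inverse (real (Suc n)) < T x \<bullet> x" for n
  proof -
    have "m - inverse (real (Suc n)) < Sup S" by (simp add: m_def)
    then show ?thesis using less_cSup_iff[OF \<open>S \<noteq> {}\<close> bdd] by (auto simp: S_def)
  qed
  then obtain x where x: "\<And>n. x n \<in> W" "\<And>n. norm (x n) = 1"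
    "\<And>n. m - inverse (real (Suc n)) < T (x n) \<bullet> x n" by metis
  obtain l r where r: "strict_mono r" "(\<lambda>n. T (x (r n))) \<longlonglongrightarrow> l"
    using compact_mapD[OF T(1), of x] x(2) by (metis order.refl)
  \<comment> \<open>On \<open>W\<close> the form of \<open>m - T\<close> is positive, so the Cauchy-Schwarz inequality for it turns a small
    value of the form into a small residual \<open>m x - T x\<close>.\<close>
  define R where "R x = m *\<^sub>R x - T x" for x
  have residual: "R x \<bullet> R x \<le> (m + K) * (m - T x \<bullet> x)" if xW: "x \<in> W" and nx: "norm x = 1" for x
  proof -
    define w where "w = R x"
    define s where "s = 1 / (m + K)"
    have s: "s > 0" "s * (m + K) = 1" using \<open>m > 0\<close> K by (auto simp: s_def)
    have wW: "w \<in> W" unfolding w_def R_def using xW W by (simp add: subspace_diff subspace_scale)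
    have vW: "x - s *\<^sub>R w \<in> W" using xW wW W by (simp add: subspace_diff subspace_scale)
    have sym: "T w \<bullet> x = w \<bullet> T x" using T(2) by (simp add: symmetric_map_def)
    have "0 \<le> R (x - s *\<^sub>R w) \<bullet> (x - s *\<^sub>R w)"
      using le[OF vW] by (simp add: R_def inner_diff_left)
    also have "\<dots> = R x \<bullet> x - 2 * s * (R x \<bullet> w) + s * s * (R w \<bullet> w)"
      using sym by (simp add: R_def T.diff T.scaleR inner_diff_left inner_diff_right inner_commute algebra_simps)
    also have "s * s * (R w \<bullet> w) \<le> s * s * ((m + K) * (w \<bullet> w))"
      using form_bound[of w] s by (intro mult_left_mono) (auto simp: R_def inner_diff_left algebra_simps)
    also have "\<dots> = s * (s * (m + K)) * (w \<bullet> w)" by (simp only: ac_simps)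
    also have "\<dots> = s * (w \<bullet> w)" using s by simp
    finally have "s * (w \<bullet> w) \<le> R x \<bullet> x" by (simp add: w_def)
    then have "(m + K) * (s * (w \<bullet> w)) \<le> (m + K) * (R x \<bullet> x)"
      using \<open>m > 0\<close> K by (intro mult_left_mono) auto
    moreover have "(m + K) * (s * (w \<bullet> w)) = (s * (m + K)) * (w \<bullet> w)" by (simp only: ac_simps)
    moreover have "R x \<bullet> x = m - T x \<bullet> x" using dot1[OF nx] by (simp add: R_def inner_diff_left)
    ultimately show ?thesis
      unfolding w_def using s by simp
  qed
  have "(\<lambda>n. R (x n) \<bullet> R (x n)) \<longlonglongrightarrow> 0"
  proof (rule tendsto_sandwich)
    show "\<forall>\<^sub>F n in sequentially. 0 \<le> R (x n) \<bullet> R (x n)" by simp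
    show "\<forall>\<^sub>F n in sequentially. R (x n) \<bullet> R (x n) \<le> (m + K) * inverse (real (Suc n))"
    proof (intro always_eventually allI)
      fix n
      have "R (x n) \<bullet> R (x n) \<le> (m + K) * (m - T (x n) \<bullet> x n)" by (rule residual[OF x(1,2)])
      also have "\<dots> \<le> (m + K) * inverse (real (Suc n))"
        using x(3)[of n] \<open>m > 0\<close> K by (intro mult_left_mono) auto
      finally show "R (x n) \<bullet> R (x n) \<le> (m + K) * inverse (real (Suc n))" .
    qed
    show "(\<lambda>n. (m + K) * inverse (real (Suc n))) \<longlonglongrightarrow> 0"
      using tendsto_mult_left[OF LIMSEQ_inverse_real_of_nat, of "m + K"] by simp
  qed auto
  then have "(\<lambda>n. sqrt (R (x n) \<bullet> R (x n))) \<longlonglongrightarrow> sqrt 0" by (rule tendsto_real_sqrt)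
  then have "(\<lambda>n. norm (R (x n))) \<longlonglongrightarrow> 0" by (simp add: norm_eq_sqrt_inner)
  then have "(\<lambda>n. R (x n)) \<longlonglongrightarrow> 0" by (rule tendsto_norm_zero_cancel)
  then have "(\<lambda>n. R (x (r n))) \<longlonglongrightarrow> 0" using LIMSEQ_subseq_LIMSEQ[OF _ r(1)] by (force simp: o_def)
  then have "(\<lambda>n. (1/m) *\<^sub>R (R (x (r n)) + T (x (r n)))) \<longlonglongrightarrow> (1/m) *\<^sub>R (0 + l)"
    using r(2) by (intro tendsto_intros)
  then have lim: "(\<lambda>n. x (r n)) \<longlonglongrightarrow> (1/m) *\<^sub>R l" using \<open>m > 0\<close> by (simp add: R_def)
  show ?thesis
  proof
    show "(1/m) *\<^sub>R l \<in> W" using closed_sequentially[OF W(2) _ lim] x by blast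
    have "(\<lambda>n. norm (x (r n))) \<longlonglongrightarrow> norm ((1/m) *\<^sub>R l)" by (intro tendsto_norm lim)
    then show "norm ((1/m) *\<^sub>R l) = 1" using x(2) LIMSEQ_unique[OF tendsto_const] by fastforce
    have "(\<lambda>n. T (x (r n))) \<longlonglongrightarrow> T ((1/m) *\<^sub>R l)" by (intro T.tendsto lim)
    then show "T ((1/m) *\<^sub>R l) = m *\<^sub>R (1/m) *\<^sub>R l"
      using r(2) LIMSEQ_unique \<open>m > 0\<close> by fastforce
  qed (use \<open>m > 0\<close> le in auto)
qed

lemma symmetric_form_zero_imp_zero:
  fixes T :: "'a::real_inner \<Rightarrow> 'a"
  assumes T: "linear T" "symmetric_map T"
    and W: "subspace W" "\<And>x. x \<in> W \<Longrightarrow> T x \<in> W"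
    and form: "\<And>x. x \<in> W \<Longrightarrow> T x \<bullet> x = 0"
    and "x \<in> W"
  shows "T x = 0"
proof -
  have "T (x + T x) \<bullet> (x + T x) = 0" using assms by (simp add: subspace_add)
  moreover have "T (T x) \<bullet> x = T x \<bullet> T x" using T(2) by (simp add: symmetric_map_def)
  moreover have "T x \<bullet> x = 0" "T (T x) \<bullet> T x = 0" using assms by simp_all
  ultimately have "T x \<bullet> T x = 0"
    by (simp add: linear_add[OF T(1)] inner_add_left inner_add_right)
  then show ?thesis by simp
qed

text \<open>
  If the form of \<open>T\<close> is positive somewhere on \<open>W\<close> its maximum is an eigenvalue, if it is negative
  somewhere its minimum is one, and if it vanishes then \<open>T\<close> is zero on \<open>W\<close>.
\<close>

lemma eigenvector_in_invariant_subspace: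
  fixes T :: "'a::real_inner \<Rightarrow> 'a"
  assumes T: "compact_map T" "symmetric_map T"
    and W: "subspace W" "closed W" "\<And>x. x \<in> W \<Longrightarrow> T x \<in> W" and "W \<noteq> {0}"
  obtains c x where "x \<in> W" "x \<noteq> 0" "T x = c *\<^sub>R x"
proof -
  consider (pos) y where "y \<in> W" "T y \<bullet> y > 0" | (neg) y where "y \<in> W" "- T y \<bullet> y > 0"
    | (zero) "\<And>y. y \<in> W \<Longrightarrow> T y \<bullet> y = 0"
    by (metis inner_minus_left less_linear neg_0_less_iff_less)
  then show thesis
  proof cases
    case pos
    obtain m x where "x \<in> W" "norm x = 1" "T x = m *\<^sub>R x"
      using top_eigenvector[OF T W pos] by metis
    then show ?thesis using that by force
  next
    case neg
    obtain m x where "x \<in> W" "norm x = 1" "- T x = m *\<^sub>R x"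
      using top_eigenvector[OF compact_map_uminus[OF T(1)] symmetric_map_uminus[OF T(2)] W(1,2) _ neg]
        W(1,3) subspace_neg by metis
    then have "x \<in> W" "x \<noteq> 0" "T x = (- m) *\<^sub>R x" by (auto simp: minus_equation_iff[of "T x"])
    then show ?thesis using that by blast
  next
    case zero
    have lin: "linear T" using T(1) by (simp add: compact_map_def bounded_linear.linear)
    obtain x where x: "x \<in> W" "x \<noteq> 0" using \<open>W \<noteq> {0}\<close> subspace_0[OF W(1)] by blast
    have "T x = 0" using symmetric_form_zero_imp_zero[OF lin T(2) W(1,3) zero x(1)] .
    then show ?thesis using that[of x 0] x by simp
  qed
qed

section \<open>Eigenvalues that depend linearly on a parameter\<close>

text \<open>
  For every \<open>\<rho> > 0\<close>, the pairs \<open>(t, \<nu>)\<close> near \<open>(0, \<rho>)\<close> such that \<open>\<nu>\<close> is an eigenvalue of \<open>P + t Q\<close>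
  lie on finitely many lines. This is a condition on each single eigenvector, without multiplicities
  and without asking the lines to consist of eigenvalues, so it passes to invariant subspaces.
  Values \<open>\<rho> < 0\<close> are covered by applying the condition to \<open>- P\<close>.
\<close>

definition locally_linear_eigenvalues :: "('a::real_normed_vector \<Rightarrow> 'a) \<Rightarrow> ('a \<Rightarrow> 'a) \<Rightarrow> bool" where
  "locally_linear_eigenvalues P Q \<longleftrightarrow> (\<forall>\<rho>>0. \<exists>F. finite F \<and>
    (\<forall>\<^sub>F (t, \<nu>) in nhds (0, \<rho>). \<forall>x. x \<noteq> 0 \<longrightarrow> P x + t *\<^sub>R Q x = \<nu> *\<^sub>R x \<longrightarrow>
      (\<exists>(\<alpha>, \<beta>)\<in>F. \<nu> = \<alpha> + t * \<beta>)))"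

text \<open>
  The heart of the argument. Let \<open>\<rho>\<close> be the largest value of the form of \<open>P\<close> on the unit sphere
  of \<open>W\<close>. For small \<open>t > 0\<close> the largest value for \<open>P + t Q\<close> is an eigenvalue close to \<open>\<rho>\<close>; infinitely
  many of these lie on the same line, which therefore is \<open>\<rho> + t \<beta>\<close>. A limit \<open>e\<close> of the corresponding
  unit eigenvectors is an eigenvector of \<open>P\<close> for \<open>\<rho>\<close> with \<open>Q e \<bullet> e \<ge> \<beta>\<close>. Second order perturbation
  theory says that the top eigenvalue must grow strictly faster than linearly in \<open>t\<close> unless \<open>e\<close> is
  also an eigenvector of \<open>Q\<close>; testing maximality on \<open>e + t y\<close> makes this precise.
\<close>

lemma common_eigenvector:
  fixes P Q :: "'a::real_inner \<Rightarrow> 'a"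
  assumes P: "compact_map P" "symmetric_map P" and Q: "compact_map Q" "symmetric_map Q"
    and W: "subspace W" "closed W" "\<And>x. x \<in> W \<Longrightarrow> P x \<in> W" "\<And>x. x \<in> W \<Longrightarrow> Q x \<in> W"
    and pos: "x0 \<in> W" "P x0 \<bullet> x0 > 0"
    and lin: "locally_linear_eigenvalues P Q"
  obtains x a b where "x \<in> W" "x \<noteq> 0" "P x = a *\<^sub>R x" "Q x = b *\<^sub>R x"
proof -
  interpret P: bounded_linear P using P(1) by (simp add: compact_map_def)
  interpret Q: bounded_linear Q using Q(1) by (simp add: compact_map_def)
  obtain K where K: "K > 0" "\<And>x. norm (Q x) \<le> norm x * K" using Q.pos_bounded by blast
  have Q_form: "\<bar>Q x \<bullet> x\<bar> \<le> K" if "norm x = 1" for x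
    using Cauchy_Schwarz_ineq2[of "Q x" x] K(2)[of x] that by simp
  have dot1: "x \<bullet> x = 1" if "norm x = 1" for x :: 'a using that by (simp add: dot_square_norm)
  define T where "T t x = P x + t *\<^sub>R Q x" for t x
  have T: "compact_map (T t)" "symmetric_map (T t)" "\<And>x. x \<in> W \<Longrightarrow> T t x \<in> W" for t
    unfolding T_def
    using P Q W by (auto intro!: compact_map_add compact_map_scaleR symmetric_map_add
        symmetric_map_scaleR subspace_add subspace_scale)
  obtain \<rho> z where \<rho>: "\<rho> > 0" and z: "z \<in> W" "norm z = 1" "P z = \<rho> *\<^sub>R z"
    and P_le: "\<And>y. y \<in> W \<Longrightarrow> P y \<bullet> y \<le> \<rho> * (y \<bullet> y)"
    using top_eigenvector[OF P W(1,2,3) pos] by metis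
  \<comment> \<open>The steps are so small that the form of \<open>P + s n Q\<close> is still positive at \<open>z\<close>.\<close>
  define s where "s n = \<rho> / (2 * K) * inverse (real (Suc n))" for n
  have s_pos: "s n > 0" for n using \<rho> K by (simp add: s_def)
  have s_lim: "s \<longlonglongrightarrow> 0"
    unfolding s_def using tendsto_mult_left[OF LIMSEQ_inverse_real_of_nat, of "\<rho> / (2 * K)"] by simp
  have T_z: "T (s n) z \<bullet> z \<ge> \<rho> - s n * K" for n
    using Q_form[OF z(2)] s_pos[of n] dot1[OF z(2)] z(3) mult_left_mono[of "- (Q z \<bullet> z)" K "s n"]
    by (simp add: T_def inner_add_left abs_le_iff)
  have "s n * K \<le> \<rho> / 2" for n
  proof -
    have "s n * K = \<rho> / 2 * inverse (real (Suc n))" using K(1) by (simp add: s_def)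
    also have "\<dots> \<le> \<rho> / 2 * 1"
      using \<rho> by (intro mult_left_mono) (auto simp: inverse_le_1_iff)
    finally show ?thesis by simp
  qed
  then have T_pos: "T (s n) z \<bullet> z > 0" for n
    using T_z[of n] \<rho> by (smt (verit) field_sum_of_halves)
  have "\<exists>m x. x \<in> W \<and> norm x = 1 \<and> T (s n) x = m *\<^sub>R x \<and> (\<forall>y\<in>W. T (s n) y \<bullet> y \<le> m * (y \<bullet> y))" for n
    using top_eigenvector[OF T(1,2) W(1,2) T(3) z(1) T_pos[of n]] by metis
  then obtain m x where x: "\<And>n. x n \<in> W" "\<And>n. norm (x n) = 1"
      and eig: "\<And>n. T (s n) (x n) = m n *\<^sub>R x n"
      and top: "\<And>n y. y \<in> W \<Longrightarrow> T (s n) y \<bullet> y \<le> m n * (y \<bullet> y)"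
    by metis
  have m_eq: "m n = P (x n) \<bullet> x n + s n * (Q (x n) \<bullet> x n)" for n
  proof -
    have "m n = T (s n) (x n) \<bullet> x n" using eig dot1[OF x(2)] by simp
    then show ?thesis by (simp add: T_def inner_add_left)
  qed
  have m_upper: "m n \<le> \<rho> + s n * (Q (x n) \<bullet> x n)" for n
    using m_eq[of n] P_le[OF x(1)[of n]] dot1[OF x(2)] by simp
  have "m \<longlonglongrightarrow> \<rho>"
  proof (rule tendsto_sandwich)
    show "\<forall>\<^sub>F n in sequentially. \<rho> - s n * K \<le> m n"
      using T_z top[OF z(1)] dot1[OF z(2)] by (intro always_eventually allI) (metis mult.right_neutral order_trans)
    show "\<forall>\<^sub>F n in sequentially. m n \<le> \<rho> + s n * K"
      using m_upper Q_form[OF x(2)] s_pos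
      by (intro always_eventually allI) (smt (verit) mult_left_mono)
    show "(\<lambda>n. \<rho> - s n * K) \<longlonglongrightarrow> \<rho>"
      using tendsto_diff[OF tendsto_const tendsto_mult_right[OF s_lim]] by fastforce
    show "(\<lambda>n. \<rho> + s n * K) \<longlonglongrightarrow> \<rho>"
      using tendsto_add[OF tendsto_const tendsto_mult_right[OF s_lim]] by fastforce
  qed
  then have lim_pair: "((\<lambda>n. (s n, m n)) \<longlongrightarrow> (0, \<rho>)) sequentially"
    using s_lim by (intro tendsto_Pair)
  obtain F where F: "finite F"
    "\<forall>\<^sub>F (t, \<nu>) in nhds (0, \<rho>). \<forall>x. x \<noteq> 0 \<longrightarrow> P x + t *\<^sub>R Q x = \<nu> *\<^sub>R x \<longrightarrow>
      (\<exists>(\<alpha>, \<beta>)\<in>F. \<nu> = \<alpha> + t * \<beta>)"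
    using lin \<rho> unfolding locally_linear_eigenvalues_def by blast
  have "\<forall>\<^sub>F n in sequentially. \<exists>p\<in>F. m n = fst p + s n * snd p"
    using filterlim_iff[THEN iffD1, OF lim_pair, rule_format, OF F(2)]
  proof eventually_elim
    case (elim n)
    have "x n \<noteq> 0" using x(2)[of n] by auto
    moreover have "P (x n) + s n *\<^sub>R Q (x n) = m n *\<^sub>R x n" using eig by (simp add: T_def)
    ultimately have "\<exists>(\<alpha>, \<beta>)\<in>F. m n = \<alpha> + s n * \<beta>" using elim by simp
    then show ?case by (auto simp: split_beta)
  qed
  then obtain N where N: "\<forall>n\<in>{N..}. \<exists>p\<in>F. m n = fst p + s n * snd p"
    by (auto simp: eventually_sequentially)
  obtain p where "infinite {n\<in>{N..}. m n = fst p + s n * snd p}"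
    using pigeonhole_infinite_rel[OF infinite_Ici F(1) N] by blast
  then obtain r :: "nat \<Rightarrow> nat" where r: "strict_mono r" "\<And>n. m (r n) = fst p + s (r n) * snd p"
    using infinite_enumerate by blast
  obtain l q where q: "strict_mono q" "(\<lambda>n. P (x (r (q n)))) \<longlonglongrightarrow> l"
    using compact_mapD[OF P(1), of "\<lambda>n. x (r n)"] x(2) by (metis order.refl)
  define k where "k = r \<circ> q"
  have k: "strict_mono k" using r q by (simp add: k_def strict_mono_o)
  define \<beta> where "\<beta> = snd p"
  note sub = LIMSEQ_subseq_LIMSEQ[OF _ k, unfolded o_def]
  have sk: "(\<lambda>n. s (k n)) \<longlonglongrightarrow> 0" and mk: "(\<lambda>n. m (k n)) \<longlonglongrightarrow> \<rho>"
    using sub[OF s_lim] sub[OF \<open>m \<longlonglongrightarrow> \<rho>\<close>] by simp_all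
  have m_lin': "m (k n) = fst p + s (k n) * \<beta>" for n using r(2) by (simp add: k_def \<beta>_def)
  have "(\<lambda>n. fst p + s (k n) * \<beta>) \<longlonglongrightarrow> fst p + 0 * \<beta>" by (intro tendsto_intros sk)
  then have "fst p = \<rho>" using LIMSEQ_unique[OF mk] by (simp add: m_lin')
  then have m_lin: "m (k n) = \<rho> + s (k n) * \<beta>" for n using m_lin' by simp
  define e where "e = (1/\<rho>) *\<^sub>R l"
  have sQ: "(\<lambda>n. s (k n) *\<^sub>R Q (x (k n))) \<longlonglongrightarrow> 0"
  proof (rule Lim_null_comparison)
    show "\<forall>\<^sub>F n in sequentially. norm (s (k n) *\<^sub>R Q (x (k n))) \<le> s (k n) * K"
    proof (intro always_eventually allI)
      fix n
      show "norm (s (k n) *\<^sub>R Q (x (k n))) \<le> s (k n) * K"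
        using K(2)[of "x (k n)"] x(2)[of "k n"] s_pos[of "k n"] by simp
    qed
    show "(\<lambda>n. s (k n) * K) \<longlonglongrightarrow> 0" using tendsto_mult_right[OF sk] by fastforce
  qed
  have Pk: "(\<lambda>n. P (x (k n))) \<longlonglongrightarrow> l" using q by (simp add: k_def)
  have m_pos: "m n > 0" for n using top[OF z(1), of n] T_pos[of n] dot1[OF z(2)] by simp
  have "(\<lambda>n. (1 / m (k n)) *\<^sub>R (P (x (k n)) + s (k n) *\<^sub>R Q (x (k n)))) \<longlonglongrightarrow> (1/\<rho>) *\<^sub>R (l + 0)"
    using \<rho> by (intro tendsto_intros mk Pk sQ) auto
  moreover have "(1 / m (k n)) *\<^sub>R (P (x (k n)) + s (k n) *\<^sub>R Q (x (k n))) = x (k n)" for n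
    using eig[of "k n"] m_pos[of "k n"] by (simp add: T_def)
  ultimately have xk: "(\<lambda>n. x (k n)) \<longlonglongrightarrow> e" by (simp add: e_def)
  have eW: "e \<in> W" using closed_sequentially[OF W(2) _ xk] x by blast
  have "(\<lambda>n. norm (x (k n))) \<longlonglongrightarrow> norm e" by (intro tendsto_norm xk)
  then have e1: "norm e = 1" using x(2) LIMSEQ_unique[OF tendsto_const] by fastforce
  have "P e = l" using LIMSEQ_unique[OF P.tendsto[OF xk] Pk] .
  then have Pe: "P e = \<rho> *\<^sub>R e" using \<rho> by (simp add: e_def)
  have \<beta>_le: "\<beta> \<le> Q e \<bullet> e"
  proof (rule LIMSEQ_le_const)
    show "(\<lambda>n. Q (x (k n)) \<bullet> x (k n)) \<longlonglongrightarrow> Q e \<bullet> e"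
      by (intro tendsto_inner Q.tendsto xk)
    have "\<beta> \<le> Q (x (k n)) \<bullet> x (k n)" for n
      using m_upper[of "k n"] s_pos[of "k n"] by (simp add: m_lin)
    then show "\<exists>N. \<forall>n\<ge>N. \<beta> \<le> Q (x (k n)) \<bullet> x (k n)" by blast
  qed
  define w where "w = Q e - \<beta> *\<^sub>R e"
  have wW: "w \<in> W" unfolding w_def using eW W by (simp add: subspace_diff subspace_scale)
  \<comment> \<open>Test the maximality of \<open>\<rho> + t \<beta>\<close> on \<open>e + t y\<close>: the terms of order 0 cancel, those of order 1
    have the sign of \<open>\<beta> - Q e \<bullet> e \<le> 0\<close>, so the second order terms must be nonpositive.\<close>
  have variation: "P y \<bullet> y - \<rho> * (y \<bullet> y) + 2 * (w \<bullet> y) \<le> 0" if yW: "y \<in> W" for y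
  proof (rule LIMSEQ_le_const)
    show "(\<lambda>n. s (k n) * (\<beta> * (y \<bullet> y) - Q y \<bullet> y)) \<longlonglongrightarrow> 0"
      using tendsto_mult_right[OF sk] by fastforce
    have "P y \<bullet> y - \<rho> * (y \<bullet> y) + 2 * (w \<bullet> y) \<le> s (k n) * (\<beta> * (y \<bullet> y) - Q y \<bullet> y)" for n
    proof -
      define t where "t = s (k n)"
      have t: "t > 0" using s_pos by (simp add: t_def)
      have vW: "e + t *\<^sub>R y \<in> W" using yW eW W by (simp add: subspace_add subspace_scale)
      have "T t (e + t *\<^sub>R y) \<bullet> (e + t *\<^sub>R y) \<le> (\<rho> + t * \<beta>) * ((e + t *\<^sub>R y) \<bullet> (e + t *\<^sub>R y))"
        using top[OF vW, of "k n"] m_lin[of n] by (simp add: t_def)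
      moreover have "Q y \<bullet> e = Q e \<bullet> y" "P y \<bullet> e = \<rho> * (e \<bullet> y)"
        using Q(2) P(2) Pe by (metis symmetric_map_def inner_commute inner_scaleR_left)+
      moreover have "e \<bullet> e = 1" using dot1[OF e1] .
      ultimately have "t * (Q e \<bullet> e) + t\<^sup>2 * (P y \<bullet> y) + 2 * t\<^sup>2 * (Q e \<bullet> y) + t ^ 3 * (Q y \<bullet> y)
          \<le> t * \<beta> + t\<^sup>2 * \<rho> * (y \<bullet> y) + 2 * t\<^sup>2 * \<beta> * (e \<bullet> y) + t ^ 3 * \<beta> * (y \<bullet> y)"
        by (simp add: T_def P.add P.scaleR Q.add Q.scaleR Pe inner_add_left inner_add_right
            inner_commute algebra_simps power2_eq_square power3_eq_cube)
      then have "t\<^sup>2 * (P y \<bullet> y - \<rho> * (y \<bullet> y) + 2 * (w \<bullet> y)) + t * (Q e \<bullet> e - \<beta>)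
          \<le> t\<^sup>2 * (t * (\<beta> * (y \<bullet> y) - Q y \<bullet> y))"
        by (simp add: w_def inner_diff_left algebra_simps power2_eq_square power3_eq_cube)
      moreover have "t * (Q e \<bullet> e - \<beta>) \<ge> 0" using \<beta>_le t by simp
      ultimately have "t\<^sup>2 * (P y \<bullet> y - \<rho> * (y \<bullet> y) + 2 * (w \<bullet> y)) \<le> t\<^sup>2 * (t * (\<beta> * (y \<bullet> y) - Q y \<bullet> y))"
        by linarith
      then show ?thesis using t by (simp add: t_def)
    qed
    then show "\<exists>N. \<forall>n\<ge>N. P y \<bullet> y - \<rho> * (y \<bullet> y) + 2 * (w \<bullet> y)
        \<le> s (k n) * (\<beta> * (y \<bullet> y) - Q y \<bullet> y)" by blast
  qed
  \<comment> \<open>For \<open>y\<close> a small multiple of \<open>w\<close> the linear term dominates.\<close>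
  have "2 * (w \<bullet> w) \<le> 0"
  proof (rule LIMSEQ_le_const)
    show "(\<lambda>n. s n * (\<rho> * (w \<bullet> w) - P w \<bullet> w)) \<longlonglongrightarrow> 0"
      using tendsto_mult_right[OF s_lim] by fastforce
    have "2 * (w \<bullet> w) \<le> s n * (\<rho> * (w \<bullet> w) - P w \<bullet> w)" for n
    proof -
      have "s n *\<^sub>R w \<in> W" using wW W by (simp add: subspace_scale)
      from variation[OF this]
      have "s n * (2 * (w \<bullet> w)) \<le> s n * (s n * (\<rho> * (w \<bullet> w) - P w \<bullet> w))"
        by (simp add: P.scaleR algebra_simps)
      then show ?thesis using s_pos[of n] by simp
    qed
    then show "\<exists>N. \<forall>n\<ge>N. 2 * (w \<bullet> w) \<le> s n * (\<rho> * (w \<bullet> w) - P w \<bullet> w)" by blast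
  qed
  then have "w = 0" by (metis inner_gt_zero_iff mult_pos_pos not_le zero_less_numeral)
  then have "Q e = \<beta> *\<^sub>R e" by (simp add: w_def)
  with eW Pe e1 show ?thesis using that by force
qed

text \<open>
  The common eigenvectors span a subspace on which \<open>P\<close> and \<open>Q\<close> commute. Its orthogonal complement
  \<open>W\<close> is invariant and contains no common eigenvector, so the form of \<open>P\<close> is neither positive nor
  negative anywhere on it, and \<open>P\<close> is zero there. The commutator \<open>C\<close> is antisymmetric and kills the
  common eigenvectors, hence maps into \<open>W\<close>, where it vanishes; thus \<open>C (C x) = 0\<close>, and antisymmetry
  gives \<open>C x = 0\<close> without any appeal to an orthogonal decomposition.
\<close>

lemma commute_of_locally_linear_eigenvalues:
  fixes P Q :: "'a::real_inner \<Rightarrow> 'a"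
  assumes P: "compact_map P" "symmetric_map P" and Q: "compact_map Q" "symmetric_map Q"
    and lin: "locally_linear_eigenvalues P Q" "locally_linear_eigenvalues (\<lambda>x. - P x) Q"
  shows "P (Q x) = Q (P x)"
proof -
  interpret P: bounded_linear P using P(1) by (simp add: compact_map_def)
  interpret Q: bounded_linear Q using Q(1) by (simp add: compact_map_def)
  have symP: "P x \<bullet> y = x \<bullet> P y" and symQ: "Q x \<bullet> y = x \<bullet> Q y" for x y
    using P(2) Q(2) by (simp_all add: symmetric_map_def)
  define E where "E = {e. (\<exists>a. P e = a *\<^sub>R e) \<and> (\<exists>b. Q e = b *\<^sub>R e)}"
  define W where "W = {v. \<forall>e\<in>E. v \<bullet> e = 0}"
  have W: "subspace W" "closed W" "\<And>x. x \<in> W \<Longrightarrow> P x \<in> W" "\<And>x. x \<in> W \<Longrightarrow> Q x \<in> W"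
  proof -
    show "subspace W" by (auto simp: subspace_def W_def inner_add_left)
    have "W = (\<Inter>e\<in>E. {v. v \<bullet> e = 0})" by (auto simp: W_def)
    also have "closed \<dots>"
      by (intro closed_INT ballI closed_Collect_eq continuous_intros)
    finally show "closed W" .
    show "\<And>x. x \<in> W \<Longrightarrow> P x \<in> W" by (auto simp: W_def E_def symP)
    show "\<And>x. x \<in> W \<Longrightarrow> Q x \<in> W" by (auto simp: W_def E_def symQ)
  qed
  have no_eig: "e = 0" if "e \<in> W" "P e = a *\<^sub>R e" "Q e = b *\<^sub>R e" for e a b
    using that unfolding W_def E_def by force
  have negative: "P y \<bullet> y \<le> 0" if "y \<in> W" for y
    using common_eigenvector[OF P Q W that _ lin(1)] no_eig by (metis not_le)
  have positive: "- P y \<bullet> y \<le> 0" if yW: "y \<in> W" for y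
  proof (rule ccontr)
    assume "\<not> - P y \<bullet> y \<le> 0"
    then have "- P y \<bullet> y > 0" by simp
    then obtain x a b where x: "x \<in> W" "x \<noteq> 0" "- P x = a *\<^sub>R x" "Q x = b *\<^sub>R x"
      using common_eigenvector[OF compact_map_uminus[OF P(1)] symmetric_map_uminus[OF P(2)] Q W(1,2) _ W(4)
          yW _ lin(2)] W(1,3) subspace_neg by metis
    have "P x = (- a) *\<^sub>R x" using x(3) by (metis minus_minus scaleR_minus_left)
    then show False using no_eig x by blast
  qed
  have P0: "P y = 0" if "y \<in> W" for y
  proof (rule symmetric_form_zero_imp_zero[OF P.linear P(2) W(1,3) _ that])
    fix y assume "y \<in> W"
    then show "P y \<bullet> y = 0" using negative[of y] positive[of y] by simp
  qed
  define C where "C x = P (Q x) - Q (P x)" for x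
  have C_E: "C e = 0" if "e \<in> E" for e
    using that by (auto simp: C_def E_def P.scaleR Q.scaleR)
  have anti: "C x \<bullet> y = - (x \<bullet> C y)" for x y
    by (simp add: C_def inner_diff_left inner_diff_right symP symQ)
  have C_W: "C y = 0" if "y \<in> W" for y
    using P0 W(4) that by (simp add: C_def Q.zero)
  have "C x \<in> W" using C_E anti by (simp add: W_def)
  then have "C (C x) = 0" by (rule C_W)
  then have "C x \<bullet> C x = 0" using anti[of x "C x"] by simp
  then show ?thesis by (simp add: C_def)
qed

section \<open>Complex Hilbert spaces and adjoints\<close>

lemma scaleC_one [simp]: "1 *\<^sub>C x = (x :: 'h::complex_hilbert_space)"
  using scaleC_of_real[of 1 x] by simp

lemma scaleC_zero_left [simp]: "0 *\<^sub>C x = (0 :: 'h::complex_hilbert_space)"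
  using scaleC_of_real[of 0 x] by simp

lemma scaleC_zero_right [simp]: "c *\<^sub>C (0 :: 'h::complex_hilbert_space) = 0"
  using scaleC_add_right[of c 0 "0::'h"] by simp

lemma scaleC_minus_left: "(- c) *\<^sub>C x = - (c *\<^sub>C (x :: 'h::complex_hilbert_space))"
  using scaleC_add_left[of "- c" c x] by (simp add: eq_neg_iff_add_eq_0)

lemma scaleC_minus_right: "c *\<^sub>C (- x) = - (c *\<^sub>C (x :: 'h::complex_hilbert_space))"
  using scaleC_add_right[of c "- x" x] by (simp add: eq_neg_iff_add_eq_0)

lemma scaleC_diff_right: "c *\<^sub>C (x - y) = c *\<^sub>C x - c *\<^sub>C (y :: 'h::complex_hilbert_space)"
  using scaleC_add_right[of c x "- y"] by (simp add: scaleC_minus_right)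

lemma scaleC_scaleR: "c *\<^sub>C (r *\<^sub>R x) = r *\<^sub>R (c *\<^sub>C (x :: 'h::complex_hilbert_space))"
  by (simp add: scaleC_scaleC mult.commute flip: scaleC_of_real)

lemma cinner_add_right: "cinner x (y + z) = cinner x y + cinner (x :: 'h::complex_hilbert_space) z"
  by (metis cinner_add_left cinner_commute complex_cnj_add)

lemma cinner_scaleC_right: "cinner x (c *\<^sub>C y) = cnj c * cinner (x :: 'h::complex_hilbert_space) y"
  by (metis cinner_scaleC_left cinner_commute complex_cnj_mult)

lemma cinner_zero_left [simp]: "cinner (0 :: 'h::complex_hilbert_space) x = 0"
  using cinner_scaleC_left[of 0 x x] by simp

lemma cinner_zero_right [simp]: "cinner x (0 :: 'h::complex_hilbert_space) = 0"
  using cinner_scaleC_right[of x 0 x] by simp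

lemma cinner_diff_left: "cinner (x - y) z = cinner x z - cinner y (z :: 'h::complex_hilbert_space)"
  using cinner_add_left[of "x - y" y z] by (simp add: algebra_simps)

lemma cinner_diff_right: "cinner z (x - y) = cinner z x - cinner z (y :: 'h::complex_hilbert_space)"
  using cinner_add_right[of z "x - y" y] by (simp add: algebra_simps)

lemma cinner_self: "cinner x x = complex_of_real ((norm (x :: 'h::complex_hilbert_space))\<^sup>2)"
proof -
  have "cinner x x \<in> \<real>" using cinner_commute[of x x] by (simp add: Reals_cnj_iff)
  then show ?thesis
    using inner_eq_Re_cinner[of x x] by (simp add: dot_square_norm complex_is_Real_iff complex_eq_iff)
qed

lemma Im_cinner: "Im (cinner x y) = Re (cinner ((- \<i>) *\<^sub>C x) (y :: 'h::complex_hilbert_space))"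
  by (simp add: cinner_scaleC_left)

lemma cinner_left_ext:
  assumes "\<And>z. cinner z x = cinner z (y :: 'h::complex_hilbert_space)"
  shows "x = y"
proof -
  have "cinner (x - y) (x - y) = 0" using assms[of "x - y"] by (simp add: cinner_diff_right)
  then show ?thesis by (simp add: cinner_self)
qed

lemma norm_scaleC: "norm (c *\<^sub>C x) = cmod c * norm (x :: 'h::complex_hilbert_space)"
proof -
  have "complex_of_real ((norm (c *\<^sub>C x))\<^sup>2) = cinner (c *\<^sub>C x) (c *\<^sub>C x)"
    by (rule cinner_self[symmetric])
  also have "\<dots> = (c * cnj c) * cinner x x" by (simp add: cinner_scaleC_left cinner_scaleC_right)
  also have "\<dots> = complex_of_real ((cmod c)\<^sup>2) * complex_of_real ((norm x)\<^sup>2)"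
    by (simp only: cinner_self complex_norm_square)
  also have "\<dots> = complex_of_real ((cmod c * norm x)\<^sup>2)"
    by (simp only: of_real_mult power_mult_distrib)
  finally have "(norm (c *\<^sub>C x))\<^sup>2 = (cmod c * norm x)\<^sup>2" by (simp only: of_real_eq_iff)
  then show ?thesis by (simp add: power2_eq_iff_nonneg)
qed

lemma bounded_linear_scaleC_right:
  "bounded_linear (\<lambda>x :: 'h::complex_hilbert_space. c *\<^sub>C x)"
  by (rule bounded_linear_intro[where K = "cmod c"])
    (simp_all add: scaleC_add_right scaleC_scaleR norm_scaleC mult.commute)

lemma bounded_linear_cinner_left:
  "bounded_linear (\<lambda>x :: 'h::complex_hilbert_space. cinner x y)"
proof (rule bounded_linear_intro[where K = "2 * norm y"])
  fix x :: 'h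
  have "cmod (cinner x y) \<le> \<bar>Re (cinner x y)\<bar> + \<bar>Im (cinner x y)\<bar>" by (rule cmod_le)
  also have "\<bar>Re (cinner x y)\<bar> \<le> norm x * norm y"
    using Cauchy_Schwarz_ineq2[of x y] by (simp add: inner_eq_Re_cinner)
  also have "\<bar>Im (cinner x y)\<bar> \<le> norm x * norm y"
    using Cauchy_Schwarz_ineq2[of "(- \<i>) *\<^sub>C x" y]
    by (simp add: inner_eq_Re_cinner norm_scaleC flip: Im_cinner)
  finally show "cmod (cinner x y) \<le> norm x * (2 * norm y)" by simp
next
  show "cinner (r *\<^sub>R x) y = r *\<^sub>R cinner x y" for r and x :: 'h
    by (simp only: scaleC_of_real[symmetric] cinner_scaleC_left scaleR_conv_of_real)
qed (rule cinner_add_left)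

text \<open>
  The representing vector is the minimizer of \<open>x \<bullet> x - 2 * f x\<close>: the parallelogram law makes every
  minimizing sequence a Cauchy sequence, and the derivative at the minimum vanishes.
\<close>

lemma riesz_representation:
  fixes f :: "'a::{real_inner,banach} \<Rightarrow> real"
  assumes "bounded_linear f"
  obtains r where "\<And>x. f x = x \<bullet> r"
proof -
  interpret f: bounded_linear f by fact
  obtain K where K: "\<And>x. norm (f x) \<le> norm x * K" using f.bounded by blast
  define J where "J x = x \<bullet> x - 2 * f x" for x
  have J_ge: "- K\<^sup>2 \<le> J x" for x
  proof -
    have "0 \<le> (norm x - K)\<^sup>2" by simp
    moreover have "f x \<le> norm x * K" using K[of x] by simp
    ultimately show ?thesis by (simp add: J_def dot_square_norm power2_diff algebra_simps)
  qed
  then have bdd: "bdd_below (range J)" by (metis bdd_belowI2)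
  define d where "d = Inf (range J)"
  have d_le: "d \<le> J x" for x unfolding d_def by (intro cInf_lower bdd) auto
  have "\<exists>x. J x < d + inverse (real (Suc n))" for n
  proof -
    have "Inf (range J) < d + inverse (real (Suc n))" by (simp add: d_def)
    then show ?thesis using cInf_less_iff[OF _ bdd] by auto
  qed
  then obtain x where x: "\<And>n. J (x n) < d + inverse (real (Suc n))" by metis
  have parallelogram: "(norm (y - z))\<^sup>2 = 2 * (J y + J z - 2 * J ((1/2) *\<^sub>R (y + z)))" for y z
    by (simp add: J_def f.add f.scaleR inner_add_left inner_add_right inner_diff_left inner_diff_right
        inner_commute field_simps flip: dot_square_norm)
  have close: "(norm (x n - x m))\<^sup>2 < 2 * (inverse (real (Suc n)) + inverse (real (Suc m)))" for n m
  proof -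
    have "a < 2 * (i + j)" if "a = 2 * (b + c - 2 * e)" "b < D + i" "c < D + j" "D \<le> e"
      for a b c D e i j :: real
      unfolding that(1) using that(2-4) by simp
    from this[OF parallelogram x x d_le] show ?thesis .
  qed
  have "Cauchy x"
  proof (rule CauchyI)
    fix \<epsilon> :: real assume "0 < \<epsilon>"
    then obtain N where N: "inverse (real (Suc N)) < \<epsilon>\<^sup>2 / 4"
      using reals_Archimedean[of "\<epsilon>\<^sup>2 / 4"] by auto
    have "norm (x m - x n) < \<epsilon>" if "m \<ge> N" "n \<ge> N" for m n
    proof -
      have "inverse (real (Suc m)) \<le> inverse (real (Suc N))" "inverse (real (Suc n)) \<le> inverse (real (Suc N))"
        using that by (simp_all add: field_simps)
      then have "2 * (inverse (real (Suc m)) + inverse (real (Suc n)))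
          \<le> 2 * (inverse (real (Suc N)) + inverse (real (Suc N)))"
        by (intro mult_left_mono add_mono) auto
      also have "\<dots> < \<epsilon>\<^sup>2" using N by simp
      finally have "(norm (x m - x n))\<^sup>2 < \<epsilon>\<^sup>2" using close[of m n] by (rule less_trans[rotated])
      then show ?thesis using \<open>0 < \<epsilon>\<close> by (simp add: power_less_imp_less_base)
    qed
    then show "\<exists>M. \<forall>m\<ge>M. \<forall>n\<ge>M. norm (x m - x n) < \<epsilon>" by blast
  qed
  then obtain r where r: "x \<longlonglongrightarrow> r" using Cauchy_convergent convergent_def by blast
  have "J r \<le> d"
  proof (rule LIMSEQ_le)
    show "(\<lambda>n. J (x n)) \<longlonglongrightarrow> J r" unfolding J_def by (intro tendsto_intros r f.tendsto)
    show "(\<lambda>n. d + inverse (real (Suc n))) \<longlonglongrightarrow> d" by (rule LIMSEQ_inverse_real_of_nat_add)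
    show "\<exists>N. \<forall>n\<ge>N. J (x n) \<le> d + inverse (real (Suc n))" using x less_imp_le by blast
  qed
  have "f y = y \<bullet> r" for y
  proof (cases "y = 0")
    case False
    define g where "g = y \<bullet> r - f y"
    define t where "t = - g / (y \<bullet> y)"
    have "J r \<le> J (r + t *\<^sub>R y)" using \<open>J r \<le> d\<close> d_le order_trans by blast
    also have "\<dots> = J r + 2 * t * g + t * t * (y \<bullet> y)"
      by (simp add: J_def g_def f.add f.scaleR inner_add_left inner_add_right inner_commute algebra_simps)
    also have "\<dots> = J r - g\<^sup>2 / (y \<bullet> y)"
      using False by (simp add: t_def field_simps power2_eq_square)
    finally have "g\<^sup>2 / (y \<bullet> y) \<le> 0" by simp
    moreover have "y \<bullet> y > 0" using False by simp
    ultimately have "g\<^sup>2 \<le> 0" by (simp add: pos_divide_le_eq del: inner_gt_zero_iff)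
    then have "g = 0" by simp
    then show ?thesis by (simp add: g_def)
  qed (simp add: f.zero)
  then show thesis by (rule that)
qed

lemma complex_linearD: "complex_linear A \<Longrightarrow> A (c *\<^sub>C x) = c *\<^sub>C A x"
  by (simp add: complex_linear_def)

text \<open>
  The real adjoint, obtained from the real Riesz theorem, is the complex one: the imaginary part of
  \<open>cinner x y\<close> is the real part of \<open>cinner ((- \<i>) *\<^sub>C x) y\<close>, and \<open>A\<close> commutes with \<open>\<i>\<close>.
\<close>

lemma cinner_hilbert_adjoint:
  fixes A :: "'h::complex_hilbert_space \<Rightarrow>\<^sub>L 'h"
  assumes "complex_linear A"
  shows "cinner (A x) y = cinner x (hilbert_adjoint A y)"
proof -
  have "\<exists>r. \<forall>x. A x \<bullet> y = x \<bullet> r" for y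
    using riesz_representation[OF bounded_linear_compose[OF bounded_linear_inner_left blinfun.bounded_linear_right]]
    by metis
  then obtain R where R: "\<And>x y. A x \<bullet> y = x \<bullet> R y" by metis
  have "bounded_linear R"
  proof (rule bounded_linear_intro[where K = "norm A"])
    have ext: "u = v" if "\<And>x. x \<bullet> u = x \<bullet> v" for u v :: 'h
      using vector_eq_ldot that by blast
    show "R (x + y) = R x + R y" for x y by (rule ext) (simp add: inner_add_right flip: R)
    show "R (c *\<^sub>R x) = c *\<^sub>R R x" for c x by (rule ext) (simp flip: R)
    show "norm (R y) \<le> norm y * norm A" for y
    proof (cases "R y = 0")
      case False
      have "norm (R y) * norm (R y) = A (R y) \<bullet> y"
        by (simp add: R dot_square_norm power2_eq_square)
      also have "\<dots> \<le> norm (A (R y)) * norm y" by (rule norm_cauchy_schwarz)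
      also have "\<dots> \<le> (norm A * norm (R y)) * norm y" by (intro mult_right_mono norm_blinfun) simp
      finally show ?thesis using False by (simp add: ac_simps)
    qed simp
  qed
  then have apply_R: "blinfun_apply (Blinfun R) = R" by (rule bounded_linear_Blinfun_apply)
  have Re_eq: "Re (cinner (A x) y) = Re (cinner x (R y))" for x y
    using R by (simp add: inner_eq_Re_cinner)
  have "cinner (A x) y = cinner x (R y)" for x y
    using Re_eq[of x y] Re_eq[of "(- \<i>) *\<^sub>C x" y] complex_linearD[OF assms]
    by (simp add: complex_eq_iff Im_cinner)
  then have "\<forall>x y. cinner (A x) y = cinner x (blinfun_apply (Blinfun R) y)" by (simp add: apply_R)
  moreover have "B = Blinfun R" if "\<forall>x y. cinner (A x) y = cinner x (blinfun_apply B y)" for B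
    by (rule blinfun_eqI, rule cinner_left_ext) (metis calculation that)
  ultimately have "\<forall>x y. cinner (A x) y = cinner x (hilbert_adjoint A y)"
    unfolding hilbert_adjoint_def by (rule theI)
  then show ?thesis by blast
qed

lemma cinner_hilbert_adjoint':
  assumes "complex_linear A"
  shows "cinner (hilbert_adjoint A x) y = cinner x (A y)"
  by (metis assms cinner_commute cinner_hilbert_adjoint)

lemma complex_linear_hilbert_adjoint:
  assumes "complex_linear A"
  shows "complex_linear (hilbert_adjoint A)"
  unfolding complex_linear_def
proof (intro allI cinner_left_ext)
  fix c x z
  show "cinner z (hilbert_adjoint A (c *\<^sub>C x)) = cinner z (c *\<^sub>C hilbert_adjoint A x)"
    by (simp add: cinner_scaleC_right flip: cinner_hilbert_adjoint[OF assms])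
qed

lemma compact_operatorD:
  assumes "compact_operator A"
  shows "complex_linear A" "compact_map (blinfun_apply A)"
proof -
  show "complex_linear A" using assms by (simp add: compact_operator_def)
  show "compact_map (blinfun_apply A)"
    unfolding compact_map_def
  proof (intro conjI allI impI)
    fix x :: "nat \<Rightarrow> 'a" assume x: "\<forall>n. norm (x n) \<le> 1"
    have "seq_compact (closure (blinfun_apply A ` cball 0 1))"
      using assms by (simp add: compact_operator_def compact_eq_seq_compact_metric)
    moreover have "\<forall>n. A (x n) \<in> closure (blinfun_apply A ` cball 0 1)"
      using x by (intro allI subsetD[OF closure_subset] imageI) simp
    ultimately show "\<exists>l r. strict_mono r \<and> (\<lambda>n. A (x (r n))) \<longlonglongrightarrow> l"
      by (elim seq_compactE) (auto simp: o_def)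
  qed (rule blinfun.bounded_linear_right)
qed

text \<open>
  Writing \<open>A'\<close> for the adjoint, \<open>(norm (A' u))\<^sup>2 = A (A' u) \<bullet> u\<close>, and \<open>A \<circ> A'\<close> is compact; so where
  \<open>A (A' (x n))\<close> converges, \<open>A' (x n)\<close> is a Cauchy sequence.
\<close>

lemma compact_map_hilbert_adjoint:
  fixes A :: "'h::complex_hilbert_space \<Rightarrow>\<^sub>L 'h"
  assumes "compact_operator A"
  shows "compact_map (blinfun_apply (hilbert_adjoint A))"
  unfolding compact_map_def
proof (intro conjI allI impI)
  let ?A' = "hilbert_adjoint A"
  note A = compact_operatorD[OF assms]
  fix x :: "nat \<Rightarrow> 'h" assume x: "\<forall>n. norm (x n) \<le> 1"
  define c where "c = inverse (norm ?A' + 1)"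
  have c: "c > 0" by (simp add: c_def add_nonneg_pos)
  have "norm (c *\<^sub>R ?A' (x n)) \<le> 1" for n
  proof -
    have "norm (?A' (x n)) \<le> norm ?A' * norm (x n)" by (rule norm_blinfun)
    also have "\<dots> \<le> norm ?A' * 1" using x by (intro mult_left_mono) auto
    finally have "norm (?A' (x n)) \<le> norm ?A' + 1" by simp
    then have "c * norm (?A' (x n)) \<le> c * (norm ?A' + 1)" using c by (intro mult_left_mono) auto
    also have "\<dots> = 1" using c by (simp add: c_def)
    finally show ?thesis using c by simp
  qed
  then obtain l r where r: "strict_mono r" "(\<lambda>n. A (c *\<^sub>R ?A' (x (r n)))) \<longlonglongrightarrow> l"
    using compact_mapD[OF A(2), of "\<lambda>n. c *\<^sub>R ?A' (x n)"] by metis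
  have "(\<lambda>n. (1 / c) *\<^sub>R A (c *\<^sub>R ?A' (x (r n)))) \<longlonglongrightarrow> (1 / c) *\<^sub>R l"
    by (intro tendsto_intros r)
  then have "(\<lambda>n. A (?A' (x (r n)))) \<longlonglongrightarrow> (1 / c) *\<^sub>R l"
    using c by (simp add: blinfun.scaleR_right)
  then have Cauchy: "Cauchy (\<lambda>n. A (?A' (x (r n))))" by (rule LIMSEQ_imp_Cauchy)
  have "Cauchy (\<lambda>n. ?A' (x (r n)))"
  proof (rule CauchyI)
    fix \<epsilon> :: real assume "0 < \<epsilon>"
    then have "0 < \<epsilon>\<^sup>2 / 2" by simp
    then obtain M where M: "\<And>m n. m \<ge> M \<Longrightarrow> n \<ge> M \<Longrightarrow> norm (A (?A' (x (r m))) - A (?A' (x (r n)))) < \<epsilon>\<^sup>2 / 2"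
      using CauchyD[OF Cauchy] by blast
    have "norm (?A' (x (r m)) - ?A' (x (r n))) < \<epsilon>" if "m \<ge> M" "n \<ge> M" for m n
    proof -
      define u where "u = x (r m) - x (r n)"
      have nu: "norm u \<le> 2"
        using norm_triangle_ineq4[of "x (r m)" "x (r n)"] x[rule_format, of "r m"] x[rule_format, of "r n"]
        unfolding u_def by linarith
      have "(norm (?A' u))\<^sup>2 = Re (cinner (?A' u) (?A' u))" by (simp add: cinner_self)
      also have "\<dots> = A (?A' u) \<bullet> u"
        by (simp add: inner_eq_Re_cinner cinner_hilbert_adjoint[OF A(1)])
      also have "\<dots> \<le> norm (A (?A' u)) * norm u" by (rule norm_cauchy_schwarz)
      also have "\<dots> \<le> norm (A (?A' u)) * 2" using nu by (intro mult_left_mono) auto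
      also have "\<dots> < \<epsilon>\<^sup>2" using M[OF that] by (simp add: u_def blinfun.diff_right)
      finally show ?thesis
        using \<open>0 < \<epsilon>\<close> by (simp add: u_def blinfun.diff_right power_less_imp_less_base)
    qed
    then show "\<exists>M. \<forall>m\<ge>M. \<forall>n\<ge>M. norm (?A' (x (r m)) - ?A' (x (r n))) < \<epsilon>" by blast
  qed
  then have "convergent (\<lambda>n. ?A' (x (r n)))" by (rule Cauchy_convergent)
  then show "\<exists>l r. strict_mono r \<and> (\<lambda>n. ?A' (x (r n))) \<longlonglongrightarrow> l"
    using r(1) unfolding convergent_def by blast
qed (rule blinfun.bounded_linear_right)

text \<open>
  For \<open>c = 1/2\<close> and \<open>c = - \<i>/2\<close> these are the real and the imaginary part of \<open>A\<close>. They are kept as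
  members of one family because all of them are symmetric, and all of them are values of the pencil
  \<open>z\<^sub>1 A + z\<^sub>2 A\<^sup>* + z\<^sub>3 B + z\<^sub>4 B\<^sup>*\<close>.
\<close>

definition hermitian_part :: "complex \<Rightarrow> ('h::complex_hilbert_space \<Rightarrow>\<^sub>L 'h) \<Rightarrow> 'h \<Rightarrow> 'h" where
  "hermitian_part c A x = c *\<^sub>C A x + cnj c *\<^sub>C hilbert_adjoint A x"

lemma compact_map_hermitian_part:
  assumes "compact_operator A"
  shows "compact_map (hermitian_part c A)"
  unfolding hermitian_part_def[abs_def]
  by (intro compact_map_add compact_map_compose_left[OF bounded_linear_scaleC_right]
      compact_map_hilbert_adjoint compact_operatorD assms)

lemma symmetric_map_hermitian_part:
  assumes "complex_linear A"
  shows "symmetric_map (hermitian_part c A)"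
  unfolding symmetric_map_def hermitian_part_def inner_eq_Re_cinner
  by (simp add: cinner_add_left cinner_add_right cinner_scaleC_left cinner_scaleC_right
      cinner_hilbert_adjoint[OF assms] cinner_hilbert_adjoint'[OF assms])

lemma hermitian_part_scaleC:
  assumes "complex_linear A"
  shows "hermitian_part c A (d *\<^sub>C x) = d *\<^sub>C hermitian_part c A x"
  by (simp add: hermitian_part_def complex_linearD[OF assms]
      complex_linearD[OF complex_linear_hilbert_adjoint[OF assms]] scaleC_add_right scaleC_scaleC mult.commute)

lemma hermitian_part_add: "hermitian_part c A (x + y) = hermitian_part c A x + hermitian_part c A y"
  by (simp add: hermitian_part_def blinfun.add_right scaleC_add_right)

lemma cartesian_decomposition:
  fixes A :: "'h::complex_hilbert_space \<Rightarrow>\<^sub>L 'h"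
  shows
  "A x = hermitian_part (1/2) A x + \<i> *\<^sub>C hermitian_part (- \<i>/2) A x"
  "hilbert_adjoint A x = hermitian_part (1/2) A x + (- \<i>) *\<^sub>C hermitian_part (- \<i>/2) A x"
proof -
  have half: "(1/2) *\<^sub>C y + (1/2) *\<^sub>C y = y" for y :: 'h
    by (simp flip: scaleC_add_left)
  show "A x = hermitian_part (1/2) A x + \<i> *\<^sub>C hermitian_part (- \<i>/2) A x"
    using half[of "A x"]
    by (simp add: hermitian_part_def scaleC_add_right scaleC_diff_right scaleC_scaleC scaleC_minus_left algebra_simps)
  show "hilbert_adjoint A x = hermitian_part (1/2) A x + (- \<i>) *\<^sub>C hermitian_part (- \<i>/2) A x"
    using half[of "hilbert_adjoint A x"]
    by (simp add: hermitian_part_def scaleC_add_right scaleC_diff_right scaleC_scaleC scaleC_minus_left algebra_simps)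
qed

section \<open>From hyperplanes to commuting operators\<close>

definition pencil ::
    "('h::complex_hilbert_space \<Rightarrow>\<^sub>L 'h) \<Rightarrow> ('h \<Rightarrow>\<^sub>L 'h) \<Rightarrow> complex ^ 4 \<Rightarrow> 'h \<Rightarrow> 'h" where
  "pencil A B z x = z $ 1 *\<^sub>C A x + z $ 2 *\<^sub>C hilbert_adjoint A x +
    z $ 3 *\<^sub>C B x + z $ 4 *\<^sub>C hilbert_adjoint B x"

lemma vector_4 [simp]:
  fixes a b c d :: "'a::zero"
  shows "vector [a, b, c, d] $ (1 :: 4) = a" "vector [a, b, c, d] $ (2 :: 4) = b"
    "vector [a, b, c, d] $ (3 :: 4) = c" "vector [a, b, c, d] $ (4 :: 4) = d"
  unfolding vector_def by simp_all

lemma joint_point_spectrum_pencil: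
  "joint_point_spectrum (vector [A, hilbert_adjoint A, B, hilbert_adjoint B]) =
    {z :: complex ^ 4. \<exists>x. x \<noteq> 0 \<and> x + pencil A B z x = 0}"
proof -
  have "{x. x + pencil A B z x = 0} \<noteq> {0} \<longleftrightarrow> (\<exists>x. x \<noteq> 0 \<and> x + pencil A B z x = 0)" for z
  proof -
    have "0 \<in> {x. x + pencil A B z x = 0}" by (simp add: pencil_def blinfun.zero_right)
    then show ?thesis by blast
  qed
  then show ?thesis
    by (simp add: joint_point_spectrum_def sum_4 pencil_def)
qed

lemma pencil_add: "pencil A B (u + v) x = pencil A B u x + pencil A B v x"
  by (simp add: pencil_def scaleC_add_left algebra_simps)

lemma pencil_scale: "pencil A B (c *s u) x = c *\<^sub>C pencil A B u x"
  by (simp add: pencil_def scaleC_add_right scaleC_scaleC)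

lemma vec_dim_full_iff: "vec.dim S = CARD('n) \<longleftrightarrow> vec.span S = (UNIV :: ('a::field ^ 'n::finite) set)"
  by (metis vec.dim_eq_full vec.span_UNIV vec_dim_card)

text \<open>
  A hyperplane \<open>p + V\<close> that misses the origin has \<open>p \<notin> V\<close>, so every vector is uniquely
  \<open>v + k p\<close> with \<open>v \<in> V\<close>, and \<open>k\<close> is the required functional. The normalization to the value 1 is
  what turns a point of the joint spectrum into a linear formula for an eigenvalue.
\<close>

lemma complex_hyperplane_functional:
  fixes S :: "(complex ^ 'n::finite) set"
  assumes "complex_hyperplane S" "0 \<notin> S"
  obtains f where "\<And>x y. f (x + y) = f x + f y" "\<And>c x. f (c *s x) = c * f x" "\<And>z. z \<in> S \<Longrightarrow> f z = 1"
proof -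
  obtain V p where V: "vec.subspace V" "vec.dim V + 1 = CARD('n)" and S: "S = (\<lambda>v. p + v) ` V"
    using assms(1) unfolding complex_hyperplane_def by blast
  have p: "p \<notin> V"
  proof
    assume "p \<in> V"
    then have "- p \<in> V" by (rule vec.subspace_neg[OF V(1)])
    then show False using assms(2) S by (metis add.right_inverse imageI)
  qed
  have span_V: "vec.span V = V" using V(1) by (simp add: vec.span_eq_iff)
  have "vec.dim (insert p V) = CARD('n)" using V(2) p unfolding vec.dim_insert span_V by simp
  then have "vec.span (insert p V) = UNIV" by (simp only: vec_dim_full_iff)
  then have "\<exists>k. z - k *s p \<in> V" for z
    using vec.span_breakdown_eq[of z p V] span_V by auto
  then obtain f where f: "\<And>z. z - f z *s p \<in> V" by metis
  have unique: "f z = k" if "z - k *s p \<in> V" for z k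
  proof (rule ccontr)
    assume "f z \<noteq> k"
    have "(z - k *s p) - (z - f z *s p) \<in> V" by (intro vec.subspace_diff V that f)
    also have "(z - k *s p) - (z - f z *s p) = (f z - k) *s p" by (simp add: vec_eq_iff algebra_simps)
    finally have "inverse (f z - k) *s ((f z - k) *s p) \<in> V" by (rule vec.subspace_scale[OF V(1)])
    moreover have "inverse (f z - k) *s ((f z - k) *s p) = p"
      unfolding vector_smult_assoc using \<open>f z \<noteq> k\<close> by simp
    ultimately show False using p by simp
  qed
  show thesis
  proof
    show "f (x + y) = f x + f y" for x y
    proof (rule unique)
      have "(x - f x *s p) + (y - f y *s p) \<in> V" by (intro vec.subspace_add V f)
      also have "(x - f x *s p) + (y - f y *s p) = x + y - (f x + f y) *s p"
        by (simp add: vec_eq_iff algebra_simps)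
      finally show "x + y - (f x + f y) *s p \<in> V" .
    qed
    show "f (c *s x) = c * f x" for c x
    proof (rule unique)
      have "c *s (x - f x *s p) \<in> V" by (intro vec.subspace_scale V f)
      also have "c *s (x - f x *s p) = c *s x - (c * f x) *s p"
        by (simp add: vec_eq_iff algebra_simps)
      finally show "c *s x - (c * f x) *s p \<in> V" .
    qed
    show "f z = 1" if "z \<in> S" for z
      by (rule unique) (use that S in \<open>auto simp: algebra_simps\<close>)
  qed
qed

text \<open>
  The kernel of a nonzero functional together with one further vector spans the whole space.
\<close>

lemma complex_hyperplane_of_functional:
  fixes v :: "complex ^ 'n::finite"
  assumes "v \<noteq> 0"
  shows "complex_hyperplane {z. 1 + (\<Sum>i\<in>UNIV. z $ i * v $ i) = 0}"
proof -
  define g where "g z = (\<Sum>i\<in>UNIV. z $ i * v $ i)" for z :: "complex ^ 'n"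
  have g_add: "g (x + y) = g x + g y" for x y by (simp add: g_def distrib_right sum.distrib)
  have g_scale: "g (c *s x) = c * g x" for c x by (simp add: g_def sum_distrib_left mult.assoc)
  have g_0: "g 0 = 0" by (simp add: g_def)
  define V where "V = {z. g z = 0}"
  have V: "vec.subspace V" unfolding vec.subspace_def V_def by (simp add: g_add g_scale g_0)
  obtain j where j: "v $ j \<noteq> 0" using assms by (auto simp: vec_eq_iff)
  define p where "p = axis j (- 1 / v $ j)"
  have "g p = (\<Sum>i\<in>UNIV. if i = j then - 1 else 0)"
    unfolding g_def p_def using j by (intro sum.cong) (auto simp: axis_def)
  then have g_p: "g p = - 1" by simp
  have "p \<notin> V" using g_p by (simp add: V_def)
  have span_V: "vec.span V = V" using V by (simp add: vec.span_eq_iff)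
  have "z \<in> vec.span (insert p V)" for z
  proof -
    have "g (z - (- g z) *s p) = 0" using g_add[of z "g z *s p"] by (simp add: g_scale g_p)
    then have "z - (- g z) *s p \<in> V" by (simp add: V_def)
    then show ?thesis unfolding vec.span_breakdown_eq span_V by blast
  qed
  then have "vec.span (insert p V) = UNIV" by blast
  then have "vec.dim (insert p V) = CARD('n)" by (simp only: vec_dim_full_iff)
  then have "vec.dim V + 1 = CARD('n)" using \<open>p \<notin> V\<close> unfolding vec.dim_insert span_V by simp
  moreover have "{z. 1 + g z = 0} = (\<lambda>v. p + v) ` V"
  proof (intro equalityI subsetI)
    fix z assume "z \<in> {z. 1 + g z = 0}"
    then have "g (z - p) = 0" using g_add[of "z - p" p] by (simp add: g_p algebra_simps)
    then show "z \<in> (\<lambda>v. p + v) ` V" by (intro image_eqI[of _ _ "z - p"]) (simp_all add: V_def)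
  qed (auto simp: V_def g_add g_p)
  ultimately show ?thesis using V unfolding complex_hyperplane_def g_def by blast
qed

text \<open>
  Let \<open>T u\<close> denote the pencil at \<open>u\<close>. If \<open>\<nu> \<noteq> 0\<close> is an eigenvalue of \<open>T u + t T v\<close>, then
  \<open>- (u + t v) / \<nu>\<close> is in the joint spectrum, hence in a hyperplane \<open>f = 1\<close>, and this says
  \<open>\<nu> = - f u - t * f v\<close>. Local finiteness at \<open>- u / \<rho>\<close> leaves finitely many \<open>f\<close>. No hyperplane
  contains the origin, since the pencil is zero there and \<open>I\<close> is injective.
\<close>

lemma locally_linear_eigenvalues_pencil:
  fixes A B :: "'h::complex_hilbert_space \<Rightarrow>\<^sub>L 'h" and \<H> :: "(complex ^ 4) set set"
  assumes hyp: "\<And>S. S \<in> \<H> \<Longrightarrow> complex_hyperplane S" and fin: "locally_finite_in euclidean \<H>"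
    and spec: "joint_point_spectrum (vector [A, hilbert_adjoint A, B, hilbert_adjoint B]) = \<Union>\<H>"
  shows "locally_linear_eigenvalues (pencil A B u) (pencil A B v)"
  unfolding locally_linear_eigenvalues_def
proof (intro allI impI)
  fix \<rho> :: real assume \<rho>: "\<rho> > 0"
  have "pencil A B 0 x = 0" for x by (simp add: pencil_def)
  then have "0 \<notin> \<Union>\<H>" unfolding spec[symmetric] joint_point_spectrum_pencil by simp
  then have "\<exists>f. (\<forall>x y. f (x + y) = f x + f y) \<and> (\<forall>c x. f (c *s x) = c * f x) \<and> (\<forall>z\<in>S. f z = 1)"
    if "S \<in> \<H>" for S
    using complex_hyperplane_functional[OF hyp[OF that]] that by (metis UnionI)
  then obtain f where f: "\<And>S x y. S \<in> \<H> \<Longrightarrow> f S (x + y) = f S x + f S y"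
    "\<And>S c x. S \<in> \<H> \<Longrightarrow> f S (c *s x) = c * f S x" "\<And>S z. S \<in> \<H> \<Longrightarrow> z \<in> S \<Longrightarrow> f S z = 1"
    by metis
  define Z where "Z t \<nu> = (- 1 / \<nu>) *\<^sub>R (u + t *\<^sub>R v)" for t \<nu> :: real
  have Z_smult: "Z t \<nu> = complex_of_real (- 1 / \<nu>) *s (u + complex_of_real t *s v)" for t \<nu>
    by (simp add: Z_def vec_eq_iff) (simp add: scaleR_conv_of_real add_divide_distrib)
  obtain N where N: "open N" "Z 0 \<rho> \<in> N" "finite {S \<in> \<H>. S \<inter> N \<noteq> {}}"
    using fin[unfolded locally_finite_in_def, THEN conjunct2, THEN bspec, of "Z 0 \<rho>"] by auto
  define F where "F = (\<lambda>S. (- Re (f S u), - Re (f S v))) ` {S \<in> \<H>. S \<inter> N \<noteq> {}}"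
  have "\<forall>\<^sub>F (t, \<nu>) in nhds (0, \<rho>). Z t \<nu> \<in> N \<and> \<nu> > 0"
  proof -
    have fst: "((\<lambda>p. fst p) \<longlongrightarrow> 0) (nhds (0 :: real, \<rho>))"
      and snd: "((\<lambda>p. snd p) \<longlongrightarrow> \<rho>) (nhds (0 :: real, \<rho>))"
      using tendsto_fst[OF filterlim_ident] tendsto_snd[OF filterlim_ident] by fastforce+
    have "((\<lambda>p. Z (fst p) (snd p)) \<longlongrightarrow> Z 0 \<rho>) (nhds (0, \<rho>))"
      unfolding Z_def using \<rho> by (intro tendsto_intros fst snd) auto
    then have "\<forall>\<^sub>F p in nhds (0, \<rho>). Z (fst p) (snd p) \<in> N"
      using N(1,2) by (rule topological_tendstoD)
    moreover have "\<forall>\<^sub>F p in nhds (0 :: real, \<rho>). snd p > 0"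
      using order_tendstoD(1)[OF snd \<rho>] .
    ultimately show ?thesis by eventually_elim auto
  qed
  then have "\<forall>\<^sub>F (t, \<nu>) in nhds (0, \<rho>). \<forall>x. x \<noteq> 0 \<longrightarrow> pencil A B u x + t *\<^sub>R pencil A B v x = \<nu> *\<^sub>R x \<longrightarrow>
      (\<exists>(\<alpha>, \<beta>)\<in>F. \<nu> = \<alpha> + t * \<beta>)"
  proof eventually_elim
    case (elim p)
    obtain t \<nu> where p: "p = (t, \<nu>)" by (cases p)
    have \<nu>: "Z t \<nu> \<in> N" "\<nu> > 0" using elim by (simp_all add: p)
    have "\<exists>(\<alpha>, \<beta>)\<in>F. \<nu> = \<alpha> + t * \<beta>"
      if x: "x \<noteq> 0" and eig: "pencil A B u x + t *\<^sub>R pencil A B v x = \<nu> *\<^sub>R x" for x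
    proof -
      have "pencil A B (Z t \<nu>) x = complex_of_real (- 1 / \<nu>) *\<^sub>C (pencil A B u x + t *\<^sub>R pencil A B v x)"
        by (simp only: Z_smult pencil_scale pencil_add scaleC_of_real)
      also have "\<dots> = - x" unfolding eig using \<nu> by (simp only: scaleC_of_real) simp
      finally have "x + pencil A B (Z t \<nu>) x = 0" by simp
      then have "Z t \<nu> \<in> \<Union>\<H>"
        unfolding spec[symmetric] joint_point_spectrum_pencil using x by blast
      then obtain S where S: "S \<in> \<H>" "Z t \<nu> \<in> S" by blast
      then have "f S (Z t \<nu>) = 1" using f(3) by blast
      then have "complex_of_real (- 1 / \<nu>) * (f S u + complex_of_real t * f S v) = 1"
        by (simp only: Z_smult f(1,2)[OF S(1)])
      moreover have "X = - complex_of_real \<nu>" if "complex_of_real (- 1 / \<nu>) * X = 1" for X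
        using that \<nu> by (simp add: field_simps) (metis minus_minus)
      ultimately have "f S u + complex_of_real t * f S v = - complex_of_real \<nu>" by blast
      then have "Re (f S u + complex_of_real t * f S v) = Re (- complex_of_real \<nu>)" by simp
      then have "\<nu> = - Re (f S u) + t * - Re (f S v)" by simp
      moreover have "(- Re (f S u), - Re (f S v)) \<in> F" using S \<nu> by (auto simp: F_def)
      ultimately show ?thesis by blast
    qed
    then show ?case by (simp add: p)
  qed
  moreover have "finite F" using N(3) by (simp add: F_def)
  ultimately show "\<exists>F. finite F \<and> (\<forall>\<^sub>F (t, \<nu>) in nhds (0, \<rho>). \<forall>x. x \<noteq> 0 \<longrightarrow>
      pencil A B u x + t *\<^sub>R pencil A B v x = \<nu> *\<^sub>R x \<longrightarrow> (\<exists>(\<alpha>, \<beta>)\<in>F. \<nu> = \<alpha> + t * \<beta>))" by blast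
qed

lemma commute_of_hermitian_parts:
  fixes A B :: "'h::complex_hilbert_space \<Rightarrow>\<^sub>L 'h"
  assumes lin: "complex_linear A" "complex_linear B"
    and comm: "\<And>c d x. c \<in> {1/2, - \<i>/2} \<Longrightarrow> d \<in> {1/2, - \<i>/2} \<Longrightarrow>
      hermitian_part c A (hermitian_part d B x) = hermitian_part d B (hermitian_part c A x)"
  shows "A (B x) = B (A x)" and "A (hilbert_adjoint B x) = hilbert_adjoint B (A x)"
proof -
  note [simp] = comm hermitian_part_add hermitian_part_scaleC[OF lin(1)] hermitian_part_scaleC[OF lin(2)]
    scaleC_add_right scaleC_scaleC
  show "A (B x) = B (A x)"
    unfolding cartesian_decomposition(1)[of A] cartesian_decomposition(1)[of B] by (simp add: algebra_simps)
  show "A (hilbert_adjoint B x) = hilbert_adjoint B (A x)"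
    unfolding cartesian_decomposition(1)[of A] cartesian_decomposition(2)[of B] by (simp add: algebra_simps)
qed

text \<open>
  The real and imaginary parts of \<open>A\<close> and \<open>B\<close> are symmetric members of the pencil, so any two of
  them commute. Normality and commutation are bilinear consequences.
\<close>

lemma normal_commute_of_hyperplanes:
  fixes A B :: "'h::complex_hilbert_space \<Rightarrow>\<^sub>L 'h" and \<H> :: "(complex ^ 4) set set"
  assumes cpt: "compact_operator A" "compact_operator B"
    and hyp: "\<And>S. S \<in> \<H> \<Longrightarrow> complex_hyperplane S" and fin: "locally_finite_in euclidean \<H>"
    and spec: "joint_point_spectrum (vector [A, hilbert_adjoint A, B, hilbert_adjoint B]) = \<Union>\<H>"
  shows "normal_operator A" "normal_operator B" "A o\<^sub>L B = B o\<^sub>L A"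
proof -
  note lin = compact_operatorD(1)[OF cpt(1)] compact_operatorD(1)[OF cpt(2)]
  have commute: "pencil A B u (pencil A B v x) = pencil A B v (pencil A B u x)"
    if "compact_map (pencil A B u)" "symmetric_map (pencil A B u)"
      "compact_map (pencil A B v)" "symmetric_map (pencil A B v)" for u v x
  proof (rule commute_of_locally_linear_eigenvalues[OF that])
    show "locally_linear_eigenvalues (pencil A B u) (pencil A B v)"
      by (rule locally_linear_eigenvalues_pencil[OF hyp fin spec])
    have "(\<lambda>x. - pencil A B u x) = pencil A B ((- 1) *s u)"
      unfolding pencil_scale by (simp add: fun_eq_iff scaleC_minus_left)
    then show "locally_linear_eigenvalues (\<lambda>x. - pencil A B u x) (pencil A B v)"
      using locally_linear_eigenvalues_pencil[OF hyp fin spec] by simp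
  qed
  have A_part: "hermitian_part c A = pencil A B (vector [c, cnj c, 0, 0])" for c
    by (simp add: fun_eq_iff hermitian_part_def pencil_def)
  have B_part: "hermitian_part c B = pencil A B (vector [0, 0, c, cnj c])" for c
    by (simp add: fun_eq_iff hermitian_part_def pencil_def)
  have "hermitian_part c A (hermitian_part d A x) = hermitian_part d A (hermitian_part c A x)" for c d x
    using compact_map_hermitian_part[OF cpt(1)] symmetric_map_hermitian_part[OF lin(1)]
    unfolding A_part by (intro commute)
  then show "normal_operator A"
    unfolding normal_operator_def using commute_of_hermitian_parts(2)[OF lin(1) lin(1)]
    by (intro blinfun_eqI) simp
  have "hermitian_part c B (hermitian_part d B x) = hermitian_part d B (hermitian_part c B x)" for c d x
    using compact_map_hermitian_part[OF cpt(2)] symmetric_map_hermitian_part[OF lin(2)]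
    unfolding B_part by (intro commute)
  then show "normal_operator B"
    unfolding normal_operator_def using commute_of_hermitian_parts(2)[OF lin(2) lin(2)]
    by (intro blinfun_eqI) simp
  have "hermitian_part c A (hermitian_part d B x) = hermitian_part d B (hermitian_part c A x)" for c d x
    using compact_map_hermitian_part[OF cpt(1)] symmetric_map_hermitian_part[OF lin(1)]
      compact_map_hermitian_part[OF cpt(2)] symmetric_map_hermitian_part[OF lin(2)]
    unfolding A_part B_part by (intro commute)
  then show "A o\<^sub>L B = B o\<^sub>L A"
    using commute_of_hermitian_parts(1)[OF lin] by (intro blinfun_eqI) simp
qed

section \<open>From commuting normal operators to hyperplanes\<close>

text \<open>
  For normal \<open>A\<close> the vectors \<open>A x - a x\<close> and \<open>A\<^sup>* x - cnj a x\<close> have the same norm.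
\<close>

lemma hilbert_adjoint_eigenvector:
  fixes A :: "'h::complex_hilbert_space \<Rightarrow>\<^sub>L 'h"
  assumes lin: "complex_linear A" and normal: "normal_operator A"
  shows "hilbert_adjoint A x = cnj a *\<^sub>C x \<longleftrightarrow> A x = a *\<^sub>C x"
proof -
  let ?A' = "hilbert_adjoint A"
  have "A (?A' x) = ?A' (A x)"
    using normal unfolding normal_operator_def by (metis blinfun_apply_blinfun_compose)
  then have "cinner (A x) (A x) = cinner (?A' x) (?A' x)"
    using cinner_hilbert_adjoint[OF lin, of x "A x"] cinner_hilbert_adjoint'[OF lin, of x "?A' x"] by simp
  moreover have "cinner (A x) x = cinner x (?A' x)" "cinner (?A' x) x = cinner x (A x)"
    by (rule cinner_hilbert_adjoint[OF lin] cinner_hilbert_adjoint'[OF lin])+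
  ultimately have "cinner (?A' x - cnj a *\<^sub>C x) (?A' x - cnj a *\<^sub>C x) = cinner (A x - a *\<^sub>C x) (A x - a *\<^sub>C x)"
    by (simp add: cinner_diff_left cinner_diff_right cinner_scaleC_left cinner_scaleC_right algebra_simps)
  then have "norm (?A' x - cnj a *\<^sub>C x) = norm (A x - a *\<^sub>C x)"
    unfolding cinner_self by (simp only: of_real_eq_iff power2_eq_iff_nonneg norm_ge_zero)
  then show ?thesis by (metis eq_iff_diff_eq_0 norm_eq_zero)
qed

text \<open>
  An eigenspace of the real part within \<open>W\<close> is invariant under the imaginary part, which therefore has
  an eigenvector there.
\<close>

lemma normal_eigenvector_in_invariant_subspace:
  fixes A :: "'h::complex_hilbert_space \<Rightarrow>\<^sub>L 'h"
  assumes A: "compact_operator A" "normal_operator A"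
    and W: "subspace W" "closed W" "\<And>c x. x \<in> W \<Longrightarrow> c *\<^sub>C x \<in> W" "W \<noteq> {0}"
    and inv: "\<And>x. x \<in> W \<Longrightarrow> A x \<in> W" "\<And>x. x \<in> W \<Longrightarrow> hilbert_adjoint A x \<in> W"
  obtains a x where "x \<in> W" "x \<noteq> 0" "A x = a *\<^sub>C x"
proof -
  note lin = compact_operatorD(1)[OF A(1)]
  note part = compact_map_hermitian_part[OF A(1)] symmetric_map_hermitian_part[OF lin]
  have part_W: "hermitian_part c A x \<in> W" if "x \<in> W" for c x
    unfolding hermitian_part_def by (intro subspace_add W inv that)
  have part_bl: "bounded_linear (hermitian_part c A)" for c
    using part(1) by (simp add: compact_map_def)
  define R J where "R = hermitian_part (1/2) A" and "J = hermitian_part (- \<i>/2) A"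
  have AA: "A (hilbert_adjoint A x) = hilbert_adjoint A (A x)" for x
    using A(2) unfolding normal_operator_def by (metis blinfun_apply_blinfun_compose)
  have comm: "R (J x) = J (R x)" for x
    unfolding R_def J_def hermitian_part_def using AA
    by (simp add: complex_linearD[OF lin] complex_linearD[OF complex_linear_hilbert_adjoint[OF lin]]
        blinfun.add_right scaleC_add_right scaleC_scaleC add_ac mult.commute)
  obtain r x where x: "x \<in> W" "x \<noteq> 0" "R x = r *\<^sub>R x"
    using eigenvector_in_invariant_subspace[OF part W(1,2) part_W W(4)] unfolding R_def by metis
  interpret R: bounded_linear R unfolding R_def by (rule part_bl)
  interpret J: bounded_linear J unfolding J_def by (rule part_bl)
  define E where "E = {y \<in> W. R y = r *\<^sub>R y}"
  have "subspace E"
    using W(1) by (auto simp: subspace_def E_def R.add R.scaleR R.zero scaleR_add_right)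
  moreover have "closed E"
  proof -
    have "E = W \<inter> {y. R y = r *\<^sub>R y}" by (auto simp: E_def)
    then show ?thesis
      using W(2) by (auto intro!: closed_Int closed_Collect_eq continuous_intros R.continuous_on)
  qed
  moreover have "J y \<in> E" if "y \<in> E" for y
    using that part_W comm[of y] by (simp add: E_def J.scaleR) (simp add: J_def)
  moreover have "E \<noteq> {0}" using x by (auto simp: E_def)
  ultimately obtain j y where y: "y \<in> E" "y \<noteq> 0" "J y = j *\<^sub>R y"
    using eigenvector_in_invariant_subspace[of J E] part unfolding J_def by metis
  have "A y = R y + \<i> *\<^sub>C J y" unfolding R_def J_def by (rule cartesian_decomposition)
  also have "\<dots> = (complex_of_real r + \<i> * complex_of_real j) *\<^sub>C y"
    using y by (simp add: E_def scaleC_add_left flip: scaleC_of_real scaleC_scaleC)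
  finally show thesis using y that by (auto simp: E_def)
qed

text \<open>
  The orthogonal complement \<open>W\<close> of all common eigenvectors is invariant under \<open>A\<close>, \<open>B\<close> and their
  adjoints. If it were not zero, it would contain an eigenspace of \<open>A\<close> and in it an eigenvector of \<open>B\<close>,
  that is a common eigenvector orthogonal to itself.
\<close>

lemma common_eigenvectors_total:
  fixes A B :: "'h::complex_hilbert_space \<Rightarrow>\<^sub>L 'h"
  assumes A: "compact_operator A" "normal_operator A" and B: "compact_operator B" "normal_operator B"
    and comm: "A o\<^sub>L B = B o\<^sub>L A" and "x \<noteq> 0"
  obtains e a b where "A e = a *\<^sub>C e" "B e = b *\<^sub>C e" "cinner x e \<noteq> 0"
proof -
  note linA = compact_operatorD(1)[OF A(1)] and linB = compact_operatorD(1)[OF B(1)]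
  note adjA = hilbert_adjoint_eigenvector[OF linA A(2)] and adjB = hilbert_adjoint_eigenvector[OF linB B(2)]
  have AB: "A (B y) = B (A y)" for y using comm by (metis blinfun_apply_blinfun_compose)
  have AB': "hilbert_adjoint A (hilbert_adjoint B y) = hilbert_adjoint B (hilbert_adjoint A y)" for y
    by (rule cinner_left_ext)
      (simp add: AB flip: cinner_hilbert_adjoint[OF linA] cinner_hilbert_adjoint[OF linB])
  define E where "E = {e. (\<exists>a. A e = a *\<^sub>C e) \<and> (\<exists>b. B e = b *\<^sub>C e)}"
  define W where "W = {v. \<forall>e\<in>E. cinner v e = 0}"
  have W_scaleC: "c *\<^sub>C v \<in> W" if "v \<in> W" for c v using that by (simp add: W_def cinner_scaleC_left)
  have W: "subspace W"
    unfolding subspace_def using W_scaleC[of _ "complex_of_real _"]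
    by (simp add: W_def cinner_add_left scaleC_of_real)
  have W_closed: "closed W"
  proof -
    have "W = (\<Inter>e\<in>E. {v. cinner v e = 0})" by (auto simp: W_def)
    also have "closed \<dots>"
      by (intro closed_INT ballI closed_Collect_eq continuous_intros
          linear_continuous_on bounded_linear_cinner_left)
    finally show ?thesis .
  qed
  have W_A: "A v \<in> W" "hilbert_adjoint A v \<in> W" if "v \<in> W" for v
    using that unfolding W_def E_def
    by (auto simp: cinner_hilbert_adjoint[OF linA] cinner_hilbert_adjoint'[OF linA] adjA[THEN iffD2] cinner_scaleC_right)
  have W_B: "B v \<in> W" "hilbert_adjoint B v \<in> W" if "v \<in> W" for v
    using that unfolding W_def E_def
    by (auto simp: cinner_hilbert_adjoint[OF linB] cinner_hilbert_adjoint'[OF linB] adjB[THEN iffD2] cinner_scaleC_right)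
  have "W = {0}"
  proof (rule ccontr)
    assume "W \<noteq> {0}"
    then obtain a y where y: "y \<in> W" "y \<noteq> 0" "A y = a *\<^sub>C y"
      using normal_eigenvector_in_invariant_subspace[OF A W W_closed W_scaleC _ W_A] by metis
    define V where "V = {y \<in> W. A y = a *\<^sub>C y}"
    have V_scaleC: "c *\<^sub>C v \<in> V" if "v \<in> V" for c v
      using that W_scaleC by (simp add: V_def complex_linearD[OF linA] scaleC_scaleC mult.commute)
    have V: "subspace V"
      unfolding subspace_def
      using V_scaleC[of _ "complex_of_real _"] subspace_0[OF W] subspace_add[OF W]
      by (simp add: V_def blinfun.add_right blinfun.zero_right scaleC_add_right scaleC_of_real)
    have V_closed: "closed V"
    proof -
      have "V = W \<inter> {y. A y = a *\<^sub>C y}" by (auto simp: V_def)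
      then show ?thesis
        using W_closed by (auto intro!: closed_Int closed_Collect_eq linear_continuous_on
            blinfun.bounded_linear_right bounded_linear_scaleC_right)
    qed
    have "B v \<in> V" if "v \<in> V" for v
      using that W_B by (simp add: V_def AB complex_linearD[OF linB])
    \<comment> \<open>\<open>B\<^sup>*\<close> commutes with \<open>A\<^sup>*\<close>, and by normality the eigenspaces of \<open>A\<close> are those of \<open>A\<^sup>*\<close>; this
      replaces Fuglede's theorem.\<close>
    moreover have "hilbert_adjoint B v \<in> V" if "v \<in> V" for v
    proof -
      have "hilbert_adjoint A (hilbert_adjoint B v) = cnj a *\<^sub>C hilbert_adjoint B v"
        using that adjA[of v a, THEN iffD2] AB'[of v]
        by (simp add: V_def complex_linearD[OF complex_linear_hilbert_adjoint[OF linB]])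
      then show ?thesis using that W_B adjA by (simp add: V_def)
    qed
    moreover have "V \<noteq> {0}" using y by (auto simp: V_def)
    ultimately obtain b e where e: "e \<in> V" "e \<noteq> 0" "B e = b *\<^sub>C e"
      using normal_eigenvector_in_invariant_subspace[OF B V V_closed V_scaleC] by metis
    then have "e \<in> E" "e \<in> W" by (auto simp: V_def E_def)
    then have "cinner e e = 0" by (simp add: W_def)
    then show False using e(2) by (simp add: cinner_self)
  qed
  then have "x \<notin> W" using \<open>x \<noteq> 0\<close> by simp
  then show thesis using that by (auto simp: W_def E_def)
qed

text \<open>
  The images of distinct \<open>e i\<close> are at distance at least \<open>c\<close> from each other, so a sequence of them has
  no convergent subsequence.
\<close>

lemma finite_of_orthonormal_eigenvectors:
  fixes T :: "'h::complex_hilbert_space \<Rightarrow> 'h"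
  assumes T: "compact_map T" and c: "c > 0"
    and e: "\<And>i. i \<in> I \<Longrightarrow> norm (e i) = 1" "\<And>i. i \<in> I \<Longrightarrow> T (e i) = a i *\<^sub>C e i"
      "\<And>i. i \<in> I \<Longrightarrow> cmod (a i) \<ge> c"
    and orth: "\<And>i j. i \<in> I \<Longrightarrow> j \<in> I \<Longrightarrow> i \<noteq> j \<Longrightarrow> cinner (e i) (e j) = 0"
  shows "finite I"
proof (rule ccontr)
  assume "infinite I"
  then obtain s :: "nat \<Rightarrow> 'a" where s: "inj s" "range s \<subseteq> I"
    using infinite_countable_subset by blast
  then have sI: "s n \<in> I" for n by blast
  obtain l r where r: "strict_mono r" "(\<lambda>n. T (e (s (r n)))) \<longlonglongrightarrow> l"
    using compact_mapD[OF T, of "\<lambda>n. e (s n)"] e(1)[OF sI] by (metis order.refl)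
  have "Cauchy (\<lambda>n. T (e (s (r n))))" using r(2) by (rule LIMSEQ_imp_Cauchy)
  then obtain N where N: "\<And>m n. m \<ge> N \<Longrightarrow> n \<ge> N \<Longrightarrow> norm (T (e (s (r m))) - T (e (s (r n)))) < c"
    using CauchyD c by blast
  define i j where "i = s (r N)" and "j = s (r (Suc N))"
  have ij: "i \<in> I" "j \<in> I" "i \<noteq> j"
    using sI s(1) r(1) by (auto simp: i_def j_def inj_eq strict_mono_eq)
  have ji: "cinner (e j) (e i) = 0" using orth ij by metis
  have "complex_of_real ((norm (a i *\<^sub>C e i - a j *\<^sub>C e j))\<^sup>2)
      = complex_of_real ((norm (a i *\<^sub>C e i))\<^sup>2) + complex_of_real ((norm (a j *\<^sub>C e j))\<^sup>2)"
    unfolding cinner_self[symmetric] using orth[OF ij] ji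
    by (simp add: cinner_diff_left cinner_diff_right cinner_scaleC_left cinner_scaleC_right)
  then have "(norm (a i *\<^sub>C e i - a j *\<^sub>C e j))\<^sup>2 = (norm (a i *\<^sub>C e i))\<^sup>2 + (norm (a j *\<^sub>C e j))\<^sup>2"
    by (simp only: of_real_add[symmetric] of_real_eq_iff)
  also have "\<dots> \<ge> (cmod (a i))\<^sup>2" using e(1)[OF ij(1)] by (simp add: norm_scaleC)
  finally have "cmod (a i) \<le> norm (a i *\<^sub>C e i - a j *\<^sub>C e j)" by (simp add: power2_le_iff_abs_le)
  moreover have "norm (a i *\<^sub>C e i - a j *\<^sub>C e j) < c"
    using N[of N "Suc N"] e(2)[OF ij(1)] e(2)[OF ij(2)] by (simp add: i_def j_def)
  ultimately show False using e(3)[OF ij(1)] by simp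
qed

definition joint_eigenvalues ::
    "('h::complex_hilbert_space \<Rightarrow>\<^sub>L 'h) \<Rightarrow> ('h \<Rightarrow>\<^sub>L 'h) \<Rightarrow> (complex \<times> complex) set" where
  "joint_eigenvalues A B = {(a, b). \<exists>e. e \<noteq> 0 \<and> A e = a *\<^sub>C e \<and> B e = b *\<^sub>C e}"

lemma orthogonal_eigenvectors:
  assumes "complex_linear A" "normal_operator A" "A x = a *\<^sub>C x" "A y = b *\<^sub>C y" "a \<noteq> b"
  shows "cinner x y = 0"
proof -
  have "a * cinner x y = cinner (A x) y" using assms(3) by (simp add: cinner_scaleC_left)
  also have "\<dots> = cinner x (cnj b *\<^sub>C y)"
    using cinner_hilbert_adjoint hilbert_adjoint_eigenvector assms by metis
  also have "\<dots> = b * cinner x y" by (simp add: cinner_scaleC_right)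
  finally show ?thesis using assms(5) by simp
qed

lemma finite_large_joint_eigenvalues:
  fixes A B :: "'h::complex_hilbert_space \<Rightarrow>\<^sub>L 'h"
  assumes A: "compact_operator A" "normal_operator A" and B: "compact_operator B" "normal_operator B"
    and c: "c > 0"
  shows "finite {p \<in> joint_eigenvalues A B. cmod (fst p) \<ge> c \<or> cmod (snd p) \<ge> c}"
proof -
  note linA = compact_operatorD(1)[OF A(1)] and linB = compact_operatorD(1)[OF B(1)]
  have "\<exists>e. norm e = 1 \<and> A e = fst p *\<^sub>C e \<and> B e = snd p *\<^sub>C e"
    if p: "p \<in> joint_eigenvalues A B" for p
  proof -
    obtain e where e: "e \<noteq> 0" "A e = fst p *\<^sub>C e" "B e = snd p *\<^sub>C e"
      using p unfolding joint_eigenvalues_def by (cases p) auto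
    define u where "u = e /\<^sub>R norm e"
    have "norm u = 1" using e by (simp add: u_def)
    moreover have "A u = fst p *\<^sub>C u" "B u = snd p *\<^sub>C u"
      using e by (simp_all add: u_def blinfun.scaleR_right scaleC_scaleR)
    ultimately show ?thesis by blast
  qed
  then obtain e where e: "\<And>p. p \<in> joint_eigenvalues A B \<Longrightarrow>
      norm (e p) = 1 \<and> A (e p) = fst p *\<^sub>C e p \<and> B (e p) = snd p *\<^sub>C e p" by metis
  have orth: "cinner (e p) (e q) = 0"
    if "p \<in> joint_eigenvalues A B" "q \<in> joint_eigenvalues A B" "p \<noteq> q" for p q
  proof (cases "fst p = fst q")
    case True
    then have "snd p \<noteq> snd q" using that(3) by (simp add: prod_eq_iff)
    then show ?thesis using orthogonal_eigenvectors[OF linB B(2)] e[OF that(1)] e[OF that(2)] by blast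
  next
    case False
    then show ?thesis using orthogonal_eigenvectors[OF linA A(2)] e[OF that(1)] e[OF that(2)] by blast
  qed
  have "finite {p \<in> joint_eigenvalues A B. cmod (fst p) \<ge> c}"
    by (rule finite_of_orthonormal_eigenvectors[OF compact_operatorD(2)[OF A(1)] c, of _ e fst])
      (simp_all add: e orth)
  moreover have "finite {p \<in> joint_eigenvalues A B. cmod (snd p) \<ge> c}"
    by (rule finite_of_orthonormal_eigenvectors[OF compact_operatorD(2)[OF B(1)] c, of _ e snd])
      (simp_all add: e orth)
  ultimately have "finite ({p \<in> joint_eigenvalues A B. cmod (fst p) \<ge> c} \<union>
      {p \<in> joint_eigenvalues A B. cmod (snd p) \<ge> c})" by simp
  then show ?thesis by (rule finite_subset[rotated]) auto
qed

definition eigenvalue_hyperplane :: "complex \<times> complex \<Rightarrow> (complex ^ 4) set" where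
  "eigenvalue_hyperplane = (\<lambda>(a, b). {z. 1 + (z $ 1 * a + z $ 2 * cnj a + z $ 3 * b + z $ 4 * cnj b) = 0})"

lemma complex_hyperplane_eigenvalue_hyperplane:
  assumes "p \<noteq> (0, 0)"
  shows "complex_hyperplane (eigenvalue_hyperplane p)"
proof -
  obtain a b where p: "p = (a, b)" by (cases p)
  define v :: "complex ^ 4" where "v = vector [a, cnj a, b, cnj b]"
  have "v $ 1 \<noteq> 0 \<or> v $ 3 \<noteq> 0" using assms by (auto simp: v_def p)
  then have "v \<noteq> 0" by auto
  from complex_hyperplane_of_functional[OF this]
  show ?thesis by (simp add: eigenvalue_hyperplane_def p sum_4 v_def)
qed

text \<open>
  On a common eigenvector \<open>e\<close> the operator \<open>I + z\<^sub>1 A + z\<^sub>2 A\<^sup>* + z\<^sub>3 B + z\<^sub>4 B\<^sup>*\<close> acts as the scalar that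
  defines the hyperplane of its joint eigenvalue. Conversely, a vector in the kernel of that operator
  is not orthogonal to some common eigenvector, and pairing with it shows that the scalar is zero.
  The joint eigenvalue \<open>(0, 0)\<close> gives the scalar 1 and contributes nothing.
\<close>

lemma joint_point_spectrum_normal:
  fixes A B :: "'h::complex_hilbert_space \<Rightarrow>\<^sub>L 'h"
  assumes A: "compact_operator A" "normal_operator A" and B: "compact_operator B" "normal_operator B"
    and comm: "A o\<^sub>L B = B o\<^sub>L A"
  shows "joint_point_spectrum (vector [A, hilbert_adjoint A, B, hilbert_adjoint B]) =
    (\<Union>p\<in>joint_eigenvalues A B - {(0, 0)}. eigenvalue_hyperplane p)"
proof -
  note linA = compact_operatorD(1)[OF A(1)] and linB = compact_operatorD(1)[OF B(1)]
  note adjA = hilbert_adjoint_eigenvector[OF linA A(2)] and adjB = hilbert_adjoint_eigenvector[OF linB B(2)]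
  have iff: "(\<exists>x. x \<noteq> 0 \<and> x + pencil A B z x = 0) \<longleftrightarrow>
      (\<exists>p\<in>joint_eigenvalues A B - {(0, 0)}. z \<in> eigenvalue_hyperplane p)" for z
  proof
    assume "\<exists>x. x \<noteq> 0 \<and> x + pencil A B z x = 0"
    then obtain x where x: "x \<noteq> 0" "x + pencil A B z x = 0" by blast
    obtain e a b where e: "A e = a *\<^sub>C e" "B e = b *\<^sub>C e" "cinner x e \<noteq> 0"
      using common_eigenvectors_total[OF A B comm x(1)] by metis
    have "0 = cinner (x + pencil A B z x) e" using x(2) by simp
    also have "\<dots> = (1 + (z $ 1 * a + z $ 2 * cnj a + z $ 3 * b + z $ 4 * cnj b)) * cinner x e"
      using e(1,2) adjA[of e a] adjB[of e b]
      by (simp add: pencil_def cinner_add_left cinner_scaleC_left cinner_hilbert_adjoint[OF linA]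
          cinner_hilbert_adjoint[OF linB] cinner_hilbert_adjoint'[OF linA] cinner_hilbert_adjoint'[OF linB]
          cinner_scaleC_right algebra_simps)
    finally have z: "1 + (z $ 1 * a + z $ 2 * cnj a + z $ 3 * b + z $ 4 * cnj b) = 0"
      using e(3) by simp
    then have "(a, b) \<noteq> (0, 0)" by auto
    moreover have "(a, b) \<in> joint_eigenvalues A B"
    proof -
      have "e \<noteq> 0" using e(3) by auto
      then show ?thesis using e(1,2) by (auto simp: joint_eigenvalues_def)
    qed
    moreover have "z \<in> eigenvalue_hyperplane (a, b)" using z by (simp add: eigenvalue_hyperplane_def)
    ultimately show "\<exists>p\<in>joint_eigenvalues A B - {(0, 0)}. z \<in> eigenvalue_hyperplane p" by blast
  next
    assume "\<exists>p\<in>joint_eigenvalues A B - {(0, 0)}. z \<in> eigenvalue_hyperplane p"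
    then obtain a b e where e: "e \<noteq> 0" "A e = a *\<^sub>C e" "B e = b *\<^sub>C e"
      and z: "1 + (z $ 1 * a + z $ 2 * cnj a + z $ 3 * b + z $ 4 * cnj b) = 0"
      by (auto simp: joint_eigenvalues_def eigenvalue_hyperplane_def)
    have "e + pencil A B z e = (1 + (z $ 1 * a + z $ 2 * cnj a + z $ 3 * b + z $ 4 * cnj b)) *\<^sub>C e"
      using e(2,3) adjA[of e a] adjB[of e b]
      by (simp add: pencil_def scaleC_scaleC scaleC_add_left)
    then show "\<exists>x. x \<noteq> 0 \<and> x + pencil A B z x = 0" using e(1) z by auto
  qed
  show ?thesis
    unfolding joint_point_spectrum_pencil by (intro set_eqI) (simp only: mem_Collect_eq UN_iff iff)
qed

text \<open>
  If both entries of \<open>p\<close> were smaller than \<open>1 / (4 * R)\<close>, each of the four summands in the equation of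
  the hyperplane would have modulus less than \<open>1 / 4\<close>, so they could not add up to \<open>- 1\<close>.
\<close>

lemma eigenvalue_hyperplane_near:
  assumes "z \<in> eigenvalue_hyperplane p" "norm z \<le> R" "R > 0"
  shows "cmod (fst p) \<ge> 1 / (4 * R) \<or> cmod (snd p) \<ge> 1 / (4 * R)"
proof (rule ccontr)
  assume "\<not> ?thesis"
  then have lt: "cmod (fst p) < 1 / (4 * R)" "cmod (snd p) < 1 / (4 * R)" by auto
  obtain a b where p: "p = (a, b)" by (cases p)
  have small: "cmod (z $ i * w) < 1 / 4" if "cmod w < 1 / (4 * R)" for i w
  proof -
    have "cmod (z $ i * w) \<le> R * cmod w"
      unfolding norm_mult using order_trans[OF Finite_Cartesian_Product.norm_nth_le assms(2)]
      by (intro mult_right_mono) auto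
    also have "\<dots> < R * (1 / (4 * R))" using assms(3) that by (intro mult_strict_left_mono)
    finally show ?thesis using assms(3) by simp
  qed
  have "z $ 1 * a + z $ 2 * cnj a + z $ 3 * b + z $ 4 * cnj b = - 1"
    using assms(1) by (simp add: eigenvalue_hyperplane_def p add_eq_0_iff)
  then have "1 = cmod (z $ 1 * a + z $ 2 * cnj a + z $ 3 * b + z $ 4 * cnj b)" by simp
  also have "\<dots> \<le> cmod (z $ 1 * a) + cmod (z $ 2 * cnj a) + cmod (z $ 3 * b) + cmod (z $ 4 * cnj b)"
    by (intro order_trans[OF norm_triangle_ineq] add_mono order.refl)
  also have "\<dots> < 1"
    using small[of a 1] small[of "cnj a" 2] small[of b 3] small[of "cnj b" 4] lt by (simp add: p)
  finally show False by simp
qed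

lemma eigenvalue_hyperplanes_locally_finite:
  fixes A B :: "'h::complex_hilbert_space \<Rightarrow>\<^sub>L 'h"
  assumes A: "compact_operator A" "normal_operator A" and B: "compact_operator B" "normal_operator B"
  defines "\<H> \<equiv> eigenvalue_hyperplane ` (joint_eigenvalues A B - {(0, 0)})"
  shows "countable \<H>" and "locally_finite_in euclidean \<H>"
proof -
  define L where "L c = {p \<in> joint_eigenvalues A B. cmod (fst p) \<ge> c \<or> cmod (snd p) \<ge> c}" for c
  have fin: "finite (L c)" if "c > 0" for c
    unfolding L_def by (rule finite_large_joint_eigenvalues[OF A B that])
  have "joint_eigenvalues A B - {(0, 0)} \<subseteq> (\<Union>n. L (inverse (real (Suc n))))"
  proof
    fix p assume p: "p \<in> joint_eigenvalues A B - {(0, 0)}"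
    then have "max (cmod (fst p)) (cmod (snd p)) > 0" by (cases p) (auto simp: less_max_iff_disj)
    then obtain n where "inverse (real (Suc n)) < max (cmod (fst p)) (cmod (snd p))"
      using reals_Archimedean by blast
    then have "p \<in> L (inverse (real (Suc n)))"
      using p unfolding L_def less_max_iff_disj by force
    then show "p \<in> (\<Union>n. L (inverse (real (Suc n))))" by blast
  qed
  moreover have "countable (\<Union>n. L (inverse (real (Suc n))))"
    by (intro countable_UN countableI_type countable_finite fin) simp
  ultimately have "countable (joint_eigenvalues A B - {(0, 0)})" by (rule countable_subset)
  then show "countable \<H>" unfolding \<H>_def by (rule countable_image)
  have "\<exists>N. openin euclidean N \<and> z \<in> N \<and> finite {S \<in> \<H>. S \<inter> N \<noteq> {}}" for z
  proof (intro exI conjI)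
    define R where "R = norm z + 1"
    have R: "R > 0" by (simp add: R_def add_nonneg_pos)
    show "openin euclidean (ball z 1)" by simp
    show "z \<in> ball z 1" by simp
    have "{S \<in> \<H>. S \<inter> ball z 1 \<noteq> {}} \<subseteq> eigenvalue_hyperplane ` L (1 / (4 * R))"
    proof
      fix S assume "S \<in> {S \<in> \<H>. S \<inter> ball z 1 \<noteq> {}}"
      then obtain w where "S \<in> \<H>" "w \<in> S" and "dist z w < 1" by auto
      then obtain p where p: "p \<in> joint_eigenvalues A B" "S = eigenvalue_hyperplane p"
        and w: "w \<in> eigenvalue_hyperplane p" "dist z w < 1"
        unfolding \<H>_def by blast
      have "norm w \<le> R"
        using w(2) norm_triangle_ineq2[of w z] by (simp add: R_def dist_norm norm_minus_commute)
      then show "S \<in> eigenvalue_hyperplane ` L (1 / (4 * R))"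
        using eigenvalue_hyperplane_near[OF w(1) _ R] p by (auto simp: L_def)
    qed
    then show "finite {S \<in> \<H>. S \<inter> ball z 1 \<noteq> {}}"
      by (rule finite_subset) (intro finite_imageI fin, use R in simp)
  qed
  then show "locally_finite_in euclidean \<H>" unfolding locally_finite_in_def by simp
qed

theorem corollaryD:
  fixes A B :: "'h::complex_hilbert_space \<Rightarrow>\<^sub>L 'h"
  assumes "compact_operator A" and "compact_operator B"
    and "A \<noteq> 0 \<or> B \<noteq> 0"
  shows "normal_operator A \<and> normal_operator B \<and> A o\<^sub>L B = B o\<^sub>L A \<longleftrightarrow>
    (\<exists>\<H> :: (complex ^ 4) set set.
        countable \<H> \<and> (\<forall>S\<in>\<H>. complex_hyperplane S) \<and> locally_finite_in euclidean \<H> \<and>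
        joint_point_spectrum (vector [A, hilbert_adjoint A, B, hilbert_adjoint B]) = \<Union>\<H>)"
    (is "?normal \<longleftrightarrow> ?hyperplanes")
proof
  assume normal: ?normal
  define \<H> where "\<H> = eigenvalue_hyperplane ` (joint_eigenvalues A B - {(0, 0)})"
  show ?hyperplanes
  proof (intro exI conjI)
    show "countable \<H>" "locally_finite_in euclidean \<H>"
      unfolding \<H>_def using eigenvalue_hyperplanes_locally_finite assms(1,2) normal by blast+
    show "\<forall>S\<in>\<H>. complex_hyperplane S"
      unfolding \<H>_def using complex_hyperplane_eigenvalue_hyperplane by blast
    show "joint_point_spectrum (vector [A, hilbert_adjoint A, B, hilbert_adjoint B]) = \<Union>\<H>"
      unfolding \<H>_def using joint_point_spectrum_normal assms(1,2) normal by blast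
  qed
next
  assume ?hyperplanes
  then obtain \<H> :: "(complex ^ 4) set set" where "\<And>S. S \<in> \<H> \<Longrightarrow> complex_hyperplane S"
    "locally_finite_in euclidean \<H>"
    "joint_point_spectrum (vector [A, hilbert_adjoint A, B, hilbert_adjoint B]) = \<Union>\<H>" by blast
  from normal_commute_of_hyperplanes[OF assms(1,2) this] show ?normal by blast
qed

end
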